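(* Let $L>0$ be fixed. The equation $$-\psi''+\omega\psi-(\kappa+\gamma B^3)\psi^5=0$$ admits $L$-periodic solutions with a snoidal profile of the form $$\psi(x)=\frac{1}{\sqrt[4]{\kappa+\gamma B^3}}\,\frac{\tilde a\,\mathrm{sn}\left(\frac{4\mathrm{K}(k)}{L}x,k\right)}{\sqrt{1-\tilde q\,\mathrm{sn}^2\left(\frac{4\mathrm{K}(k)}{L}x,k\right)}},$$ where the parameters $\tilde a\in\left(-\frac{2\sqrt3}{3}\sqrt{\frac{\pi}{L}},0\right)$, $\tilde q\in\left(\frac23,1\right)$ and the frequency $\omega\in\left(\frac{4\pi^2}{L^2},+\infty\right)$ depend smoothly on $k\in(0,1)$ and $L>0$ and are given by $$\tilde a=-\frac{a\sqrt{1-k^2}}{\sqrt{1-q}},\qquad \tilde q=\frac{k^2-q}{1-q},\qquad \omega=\frac{16\mathrm{K}(k)^2\sqrt{k^4-k^2+1}}{L^2},$$ with $a=\frac{2}{L}\left[\left(2-k^2+2\sqrt{k^4-k^2+1}\right)L^2\mathrm{K}(k)^2\right]^{1/4}$ and $q=-1+k^2-\sqrt{k^4-k^2+1}$. Moreover, the mapping $$\omega\in\left(\tfrac{4\pi^2}{L^2},+\infty\right)\longmapsto\psi_\omega=\psi\in H^2_{\rm per}$$ is a smooth curve of periodic solutions of the equation.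
   Context: $\kappa>0$ and $\gamma\ge0$ are real constants, and $B\in\mathbb{R}$ is one of the solutions $B=\frac{\gamma\pm\sqrt{\gamma^2-4\kappa^2}}{2\kappa}$ (considered for $\gamma>2\kappa$), $B=1$, or $B=-1$ (considered for $0\le\gamma<\kappa$) of $\kappa+\gamma B^3=\kappa B^4+\gamma B$; in all these cases $\kappa+\gamma B^3>0$. The constants $\kappa,\gamma,B$ are fixed. $\mathrm{sn}(\cdot,k)$ is the Jacobi elliptic sine of modulus $k\in(0,1)$ and $\mathrm{K}(k)$ is the complete elliptic integral of the first kind. $H^2_{\rm per}$ is the Sobolev space of $L$-periodic functions. In the smooth curve, $\psi_\omega$ is the snoidal function whose modulus $k\in(0,1)$ corresponds to $\omega$ through the stated relation between $\omega$ and $k$. *)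

theory Defs
  imports "HOL-Analysis.Analysis"
begin

subsection \<open>Jacobi elliptic sine (modulus convention)\<close>

text \<open>The interval integral is signed, so this is also correct for \<open>\<phi> < 0\<close>.\<close>
definition ellF :: "real \<Rightarrow> real \<Rightarrow> real" where
  "ellF \<phi> k = (LBINT t=ereal 0..ereal \<phi>. 1 / sqrt (1 - k\<^sup>2 * (sin t)\<^sup>2))"

definition ellK :: "real \<Rightarrow> real" where
  "ellK k = ellF (pi / 2) k"

text \<open>For \<open>0 < k < 1\<close> the map \<open>\<phi> \<mapsto> ellF \<phi> k\<close> is a bijection of the real line; its inverse is the
  amplitude. Outside that range of moduli the value is irrelevant.\<close>
definition jacobi_am :: "real \<Rightarrow> real \<Rightarrow> real" where
  "jacobi_am u k = (THE \<phi>. ellF \<phi> k = u)"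

definition jacobi_sn :: "real \<Rightarrow> real \<Rightarrow> real" where
  "jacobi_sn u k = sin (jacobi_am u k)"


subsection \<open>Parameters and the snoidal profile\<close>

definition par_a :: "real \<Rightarrow> real \<Rightarrow> real" where
  "par_a k L = 2 / L * root 4 ((2 - k\<^sup>2 + 2 * sqrt (k^4 - k\<^sup>2 + 1)) * L\<^sup>2 * (ellK k)\<^sup>2)"

definition par_q :: "real \<Rightarrow> real" where
  "par_q k = - 1 + k\<^sup>2 - sqrt (k^4 - k\<^sup>2 + 1)"

definition a_tilde :: "real \<Rightarrow> real \<Rightarrow> real" where
  "a_tilde k L = - (par_a k L * sqrt (1 - k\<^sup>2)) / sqrt (1 - par_q k)"

definition q_tilde :: "real \<Rightarrow> real" where
  "q_tilde k = (k\<^sup>2 - par_q k) / (1 - par_q k)"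

definition freq :: "real \<Rightarrow> real \<Rightarrow> real" where
  "freq k L = 16 * (ellK k)\<^sup>2 * sqrt (k^4 - k\<^sup>2 + 1) / L\<^sup>2"

definition snoidal :: "real \<Rightarrow> real \<Rightarrow> real \<Rightarrow> real \<Rightarrow> real \<Rightarrow> real \<Rightarrow> real" where
  "snoidal \<kappa> \<gamma> B L k x =
     1 / root 4 (\<kappa> + \<gamma> * B^3) *
     (a_tilde k L * jacobi_sn (4 * ellK k / L * x) k /
      sqrt (1 - q_tilde k * (jacobi_sn (4 * ellK k / L * x) k)\<^sup>2))"

definition modulus_of :: "real \<Rightarrow> real \<Rightarrow> real" where
  "modulus_of L \<omega> = (THE k. 0 < k \<and> k < 1 \<and> freq k L = \<omega>)"

definition psi :: "real \<Rightarrow> real \<Rightarrow> real \<Rightarrow> real \<Rightarrow> real \<Rightarrow> real \<Rightarrow> real" where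
  "psi \<kappa> \<gamma> B L \<omega> = snoidal \<kappa> \<gamma> B L (modulus_of L \<omega>)"


subsection \<open>Periodic classical solutions\<close>

definition periodic_with :: "real \<Rightarrow> (real \<Rightarrow> real) \<Rightarrow> bool" where
  "periodic_with L f \<longleftrightarrow> (\<forall>x. f (x + L) = f x)"

definition solves_eq :: "real \<Rightarrow> real \<Rightarrow> real \<Rightarrow> real \<Rightarrow> (real \<Rightarrow> real) \<Rightarrow> bool" where
  "solves_eq \<kappa> \<gamma> B \<omega> f \<longleftrightarrow>
     (\<exists>f' f''. \<forall>x. (f has_real_derivative f' x) (at x) \<and> (f' has_real_derivative f'' x) (at x) \<and>
        - f'' x + \<omega> * f x - (\<kappa> + \<gamma> * B^3) * (f x)^5 = 0)"


subsection \<open>Smooth maps on open subsets of Euclidean spaces\<close>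

text \<open>In finite dimension, continuity of all iterated directional derivatives is the same as
  continuity of the Frechet derivatives in operator norm.\<close>
primrec Ck_on :: "nat \<Rightarrow> 'a::euclidean_space set \<Rightarrow> ('a \<Rightarrow> 'b::real_normed_vector) \<Rightarrow> bool" where
  "Ck_on 0 S f \<longleftrightarrow> continuous_on S f"
| "Ck_on (Suc n) S f \<longleftrightarrow>
     (\<forall>x\<in>S. f differentiable (at x)) \<and>
     (\<forall>v. Ck_on n S (\<lambda>x. frechet_derivative f (at x) v))"

definition smooth_on :: "'a::euclidean_space set \<Rightarrow> ('a \<Rightarrow> 'b::real_normed_vector) \<Rightarrow> bool" where
  "smooth_on S f \<longleftrightarrow> (\<forall>n. Ck_on n S f)"


subsection \<open>The periodic Sobolev space of order two\<close>

definition fourier_coeff :: "real \<Rightarrow> (real \<Rightarrow> real) \<Rightarrow> int \<Rightarrow> complex" where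
  "fourier_coeff L f n =
     (LINT x:{0..L}|lebesgue.
        complex_of_real (f x) * exp (- (2 * of_real pi * \<i> * of_int n * of_real x / of_real L)))
     / of_real L"

text \<open>Elements are represented by functions rather than almost-everywhere classes, so
  \<open>H2per_norm\<close> is a seminorm whose kernel consists of the functions vanishing almost everywhere.\<close>
definition H2per :: "real \<Rightarrow> (real \<Rightarrow> real) set" where
  "H2per L = {f. periodic_with L f \<and> f \<in> borel_measurable lebesgue \<and>
     set_integrable lebesgue {0..L} (\<lambda>x. (f x)\<^sup>2) \<and>
     (\<lambda>n::int. (1 + (of_int n)\<^sup>2)\<^sup>2 * (cmod (fourier_coeff L f n))\<^sup>2) summable_on UNIV}"

definition H2per_norm :: "real \<Rightarrow> (real \<Rightarrow> real) \<Rightarrow> real" where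
  "H2per_norm L f =
     sqrt (L * (\<Sum>\<^sub>\<infinity>n::int. (1 + (of_int n)\<^sup>2)\<^sup>2 * (cmod (fourier_coeff L f n))\<^sup>2))"

text \<open>A curve in the normed space \<open>H2per L\<close> over an open set \<open>I\<close> of parameters is smooth if it has
  derivatives \<open>D n\<close> of all orders, each the limit in norm of difference quotients. The space
  depends on the parameter \<open>L\<close>, hence is not a type and \<open>has_vector_derivative\<close> does not apply.\<close>
definition smooth_H2per_curve :: "real \<Rightarrow> real set \<Rightarrow> (real \<Rightarrow> real \<Rightarrow> real) \<Rightarrow> bool" where
  "smooth_H2per_curve L I \<Gamma> \<longleftrightarrow>
     (\<exists>D :: nat \<Rightarrow> real \<Rightarrow> real \<Rightarrow> real.
        (\<forall>w\<in>I. D 0 w = \<Gamma> w) \<and>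
        (\<forall>n. \<forall>w\<in>I. D n w \<in> H2per L \<and>
           ((\<lambda>h. H2per_norm L (\<lambda>x. (D n (w + h) x - D n w x) / h - D (Suc n) w x)) \<longlongrightarrow> 0) (at 0)))"

end

theory Submission
  imports Defs
begin

text \<open>
  The amplitude \<open>\<phi>(x) = am (4 K x / L)\<close> satisfies \<open>\<phi>' = \<beta> sqrt (1 - k\<^sup>2 sin\<^sup>2 \<phi>)\<close> with \<open>\<beta> = 4 K / L\<close>. Substituting the
  profile \<open>a sin \<phi> / sqrt (1 - q sin\<^sup>2 \<phi>)\<close> into the equation and clearing denominators leaves an identity between quadratic
  polynomials in \<open>sin\<^sup>2 \<phi>\<close>; its three coefficients are exactly what the given formulas for the parameters satisfy
  (\<open>quintic_ode_of_amplitude\<close>, \<open>q_tilde_identities\<close>). Periodicity comes from \<open>am (u + 4 K) = am u + 2 \<pi>\<close>.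

  The range of the frequency rests on the inequality \<open>K' \<ge> k K / 2\<close> (\<open>deriv_ellK_ge\<close>), which makes the frequency strictly
  increasing with positive derivative, together with its value at \<open>k = 0\<close> and the logarithmic blow-up of \<open>K\<close> at \<open>k = 1\<close>. The
  range of the amplitude follows from the bound \<open>K \<le> \<pi> / (2 sqrt (1 - k\<^sup>2))\<close>.

  Smoothness is obtained in two steps. The incomplete integral is smooth in both variables by differentiation under the
  integral sign (\<open>Ck_on_integral\<close>); the amplitude and the modulus as a function of the frequency are inverses of
  smooth maps with invertible derivative (\<open>smooth_on_left_inverse\<close>). Hence the profile is jointly smooth in frequency and
  position. For a jointly smooth family of periodic functions, difference quotients in the parameter converge uniformly
  over a period, also after three derivatives in position, and three bounded derivatives control the Sobolev norm of order
  two through the decay of Fourier coefficients (\<open>H2per_bound\<close>, \<open>smooth_H2per_curveI\<close>).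
\<close>

section \<open>Calculus of smooth maps\<close>

lemma Ck_on_cong:
  assumes "open S" "\<And>x. x \<in> S \<Longrightarrow> f x = g x" "Ck_on n S f"
  shows "Ck_on n S g"
  using assms
proof (induction n arbitrary: f g)
  case 0
  then show ?case by (simp cong: continuous_on_cong)
next
  case (Suc n)
  have diff: "f differentiable (at x)" if "x \<in> S" for x using Suc.prems that by simp
  have "g differentiable (at x)" if "x \<in> S" for x
    using diff[OF that] has_derivative_transform_within_open[of f _ x UNIV S g, OF _ Suc.prems(1) that Suc.prems(2)]
    unfolding differentiable_def by blast
  moreover have "Ck_on n S (\<lambda>x. frechet_derivative g (at x) v)" for v
  proof (rule Suc.IH[OF Suc.prems(1)])
    show "frechet_derivative f (at x) v = frechet_derivative g (at x) v" if "x \<in> S" for x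
      using frechet_derivative_transform_within_open[OF diff[OF that] Suc.prems(1) that Suc.prems(2)]
      by simp
  qed (use Suc.prems in simp)
  ultimately show ?case by simp
qed

text \<open>The predicate for order \<open>Suc n\<close> speaks of \<^const>\<open>frechet_derivative\<close>, a choice. This rule admits any
  derivative written down by hand, and with it every closure property below becomes an induction on the
  order that copies the corresponding differentiation rule.\<close>

lemma Ck_on_SucI:
  assumes "open S" "\<And>x. x \<in> S \<Longrightarrow> (f has_derivative f' x) (at x)"
    and "\<And>v. Ck_on n S (\<lambda>x. f' x v)"
  shows "Ck_on (Suc n) S f"
proof -
  have "Ck_on n S (\<lambda>x. frechet_derivative f (at x) v)" for v
  proof (rule Ck_on_cong[OF assms(1) _ assms(3)])
    show "f' x v = frechet_derivative f (at x) v" if "x \<in> S" for x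
      using frechet_derivative_at[OF assms(2)[OF that]] by simp
  qed
  then show ?thesis using assms(2) by (auto simp: differentiable_def)
qed

lemma Ck_on_SucD:
  assumes "Ck_on (Suc n) S f"
  shows "x \<in> S \<Longrightarrow> (f has_derivative frechet_derivative f (at x)) (at x)"
    and "Ck_on n S (\<lambda>x. frechet_derivative f (at x) v)"
  using assms by (auto simp: frechet_derivative_works)

lemma Ck_on_Suc_imp_Ck_on: "Ck_on (Suc n) S f \<Longrightarrow> Ck_on n S f"
proof (induction n arbitrary: f)
  case 0
  then show ?case
    by (simp add: continuous_at_imp_continuous_on differentiable_imp_continuous_within)
next
  case (Suc n)
  then show ?case using Ck_on.simps(2)[of "Suc n" S f] Ck_on.simps(2)[of n S f] by blast
qed

lemma Ck_on_imp_continuous_on: "Ck_on n S f \<Longrightarrow> continuous_on S f"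
proof (induction n)
  case (Suc n)
  then show ?case using Ck_on_Suc_imp_Ck_on by blast
qed simp

lemma Ck_on_const: "open S \<Longrightarrow> Ck_on n S (\<lambda>x. c)"
proof (induction n arbitrary: c)
  case (Suc n)
  show ?case by (rule Ck_on_SucI[OF Suc.prems has_derivative_const Suc.IH[OF Suc.prems]])
qed simp

lemma Ck_on_bounded_linear:
  assumes "open S" "bounded_linear T"
  shows "Ck_on n S T"
proof (cases n)
  case 0
  then show ?thesis using assms by (simp add: linear_continuous_on)
next
  case (Suc m)
  show ?thesis unfolding Suc
    by (rule Ck_on_SucI[OF assms(1) bounded_linear_imp_has_derivative[OF assms(2)] Ck_on_const[OF assms(1)]])
qed

lemma Ck_on_bounded_linear_comp:
  assumes "open S" "bounded_linear T" "Ck_on n S f"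
  shows "Ck_on n S (\<lambda>x. T (f x))"
  using assms(3)
proof (induction n arbitrary: f)
  case 0
  then show ?case using assms by (auto intro: bounded_linear.continuous_on)
next
  case (Suc n)
  show ?case
    by (rule Ck_on_SucI[OF assms(1) bounded_linear.has_derivative[OF assms(2) Ck_on_SucD(1)[OF Suc.prems]]
          Suc.IH[OF Ck_on_SucD(2)[OF Suc.prems]]])
qed

lemma Ck_on_add:
  assumes "open S" "Ck_on n S f" "Ck_on n S g"
  shows "Ck_on n S (\<lambda>x. f x + g x)"
  using assms(2,3)
proof (induction n arbitrary: f g)
  case 0
  then show ?case by (auto intro: continuous_on_add)
next
  case (Suc n)
  show ?case
    by (rule Ck_on_SucI[OF assms(1)
          has_derivative_add[OF Ck_on_SucD(1)[OF Suc.prems(1)] Ck_on_SucD(1)[OF Suc.prems(2)]]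
          Suc.IH[OF Ck_on_SucD(2)[OF Suc.prems(1)] Ck_on_SucD(2)[OF Suc.prems(2)]]])
qed

lemma Ck_on_sum:
  assumes "open S" "finite I" "\<And>i. i \<in> I \<Longrightarrow> Ck_on n S (f i)"
  shows "Ck_on n S (\<lambda>x. \<Sum>i\<in>I. f i x)"
  using assms(2,3)
  by (induction I rule: finite_induct) (auto intro!: Ck_on_add Ck_on_const assms(1))

lemma Ck_on_scaleR:
  fixes f :: "'a::euclidean_space \<Rightarrow> real"
  assumes "open S" "Ck_on n S f" "Ck_on n S g"
  shows "Ck_on n S (\<lambda>x. f x *\<^sub>R g x)"
  using assms(2,3)
proof (induction n arbitrary: f g)
  case 0
  then show ?case by (auto intro: continuous_on_scaleR)
next
  case (Suc n)
  show ?case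
  proof (rule Ck_on_SucI[OF assms(1)])
    fix x assume "x \<in> S"
    then show "((\<lambda>x. f x *\<^sub>R g x) has_derivative
        (\<lambda>v. f x *\<^sub>R frechet_derivative g (at x) v + frechet_derivative f (at x) v *\<^sub>R g x)) (at x)"
      using Suc.prems by (intro has_derivative_scaleR Ck_on_SucD)
  next
    fix v
    show "Ck_on n S (\<lambda>x. f x *\<^sub>R frechet_derivative g (at x) v + frechet_derivative f (at x) v *\<^sub>R g x)"
      using Suc by (intro Ck_on_add Suc.IH Ck_on_SucD(2) assms(1)) (auto intro: Ck_on_Suc_imp_Ck_on simp del: Ck_on.simps)
  qed
qed

text \<open>The chain rule expresses the derivative of \<open>f \<circ> g\<close> through \<open>f' \<circ> g\<close>, where \<open>f'\<close> is only known to be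
  of class \<open>n\<close> along fixed directions. Expanding the inner derivative in the standard basis makes the
  directions fixed, at the price of scalar coefficients.\<close>

lemma Ck_on_compose:
  fixes g :: "'a::euclidean_space \<Rightarrow> 'b::euclidean_space"
  assumes "open S" "Ck_on n S g" "Ck_on n T f" "\<And>x. x \<in> S \<Longrightarrow> g x \<in> T"
  shows "Ck_on n S (\<lambda>x. f (g x))"
  using assms(2,3)
proof (induction n arbitrary: f)
  case 0
  then show ?case using assms(4) by (auto intro: continuous_on_compose2)
next
  case (Suc n)
  let ?f' = "\<lambda>x. frechet_derivative f (at x)" and ?g' = "\<lambda>x. frechet_derivative g (at x)"
  show ?case
  proof (rule Ck_on_SucI[OF assms(1)])
    fix x assume x: "x \<in> S"
    have d: "(f has_derivative ?f' (g x)) (at (g x))"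
      using Ck_on_SucD(1)[OF Suc.prems(2)] assms(4) x by blast
    interpret bounded_linear "?f' (g x)" using d by (rule has_derivative_bounded_linear)
    have "?f' (g x) w = (\<Sum>b\<in>Basis. (w \<bullet> b) *\<^sub>R ?f' (g x) b)" for w
      using arg_cong[OF euclidean_representation[of w], of "?f' (g x)"] by (simp only: sum scaleR)
    then have "?f' (g x) \<circ> ?g' x = (\<lambda>v. \<Sum>b\<in>Basis. (?g' x v \<bullet> b) *\<^sub>R ?f' (g x) b)"
      unfolding fun_eq_iff o_apply by blast
    then show "((\<lambda>x. f (g x)) has_derivative
        (\<lambda>v. \<Sum>b\<in>Basis. (?g' x v \<bullet> b) *\<^sub>R ?f' (g x) b)) (at x)"
      using diff_chain_at[OF Ck_on_SucD(1)[OF Suc.prems(1) x] d] unfolding o_def by metis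
  next
    fix v
    have "Ck_on n S g" using Suc.prems(1) by (rule Ck_on_Suc_imp_Ck_on)
    then show "Ck_on n S (\<lambda>x. \<Sum>b\<in>Basis. (?g' x v \<bullet> b) *\<^sub>R ?f' (g x) b)"
      using Suc.prems
      by (intro Ck_on_sum Ck_on_scaleR Ck_on_bounded_linear_comp[OF _ bounded_linear_inner_left]
          Suc.IH Ck_on_SucD(2) assms(1)) auto
  qed
qed

text \<open>Differentiation under the integral sign, with the direction of differentiation in the parameter.
  The derivative is again an integral of the same form, so the induction runs over all integrands at once.
  The Leibniz rule wants the derivative as a continuous family of bounded operators; continuity of such a
  family is checked on basis vectors.\<close>

lemma Ck_on_integral:
  fixes h :: "'a::euclidean_space \<times> real \<Rightarrow> 'b::banach"
  assumes "open Y" "convex Y" "Ck_on n (Y \<times> UNIV) h"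
  shows "Ck_on n Y (\<lambda>y. integral {0..1} (\<lambda>s. h (y, s)))"
  using assms(3)
proof (induction n arbitrary: h)
  case 0
  then have "continuous_on (Y \<times> cbox 0 1) (\<lambda>(y, s). h (y, s))"
    by (auto intro: continuous_on_subset)
  from integral_continuous_on_param[OF this] show ?case by simp
next
  case (Suc n)
  let ?h' = "\<lambda>z. frechet_derivative h (at z)"
  have opn: "open (Y \<times> (UNIV :: real set))" by (simp add: assms(1) open_Times)
  have d: "(h has_derivative ?h' (y, s)) (at (y, s))" if "y \<in> Y" for y s
    using Ck_on_SucD(1)[OF Suc.prems] that by simp
  have cont: "continuous_on (Y \<times> UNIV) h" 
    by (rule Ck_on_imp_continuous_on[OF Suc.prems])
  have d1: "((\<lambda>y. h (y, s)) has_derivative (\<lambda>v. ?h' (y, s) (v, 0))) (at y)" if "y \<in> Y" for y s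
    using d[OF that, of s]
    by (auto intro!: derivative_eq_intros has_derivative_compose[of "\<lambda>y. (y, s)" _ y UNIV h])
  define H where "H y s = Blinfun (\<lambda>v. ?h' (y, s) (v, 0))" for y s
  have H: "blinfun_apply (H y s) = (\<lambda>v. ?h' (y, s) (v, 0))" if "y \<in> Y" for y s
    unfolding H_def using has_derivative_bounded_linear[OF d1[OF that]]
    by (rule bounded_linear_Blinfun_apply)
  have contH: "continuous_on (Y \<times> {0..1}) (\<lambda>(y, s). H y s)"
  proof (rule continuous_on_blinfun_componentwise)
    fix i :: 'a
    have "continuous_on (Y \<times> UNIV) (\<lambda>z. ?h' z (i, 0))"
      by (rule Ck_on_imp_continuous_on[OF Ck_on_SucD(2)[OF Suc.prems]])
    then have "continuous_on (Y \<times> {0..1}) (\<lambda>z. ?h' z (i, 0))"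
      by (rule continuous_on_subset) auto
    then show "continuous_on (Y \<times> {0..1}) (\<lambda>z. blinfun_apply (case z of (y, s) \<Rightarrow> H y s) i)"
      by (rule continuous_on_eq) (auto simp: H)
  qed
  have int: "(\<lambda>s. h (y, s)) integrable_on {0..1}" if "y \<in> Y" for y
    using that
    by (intro integrable_continuous_real continuous_on_compose2[OF cont]) (auto intro!: continuous_intros)
  have intH: "H y integrable_on {0..1}" if "y \<in> Y" for y
    using that continuous_on_compose2[OF contH, of "{0..1}" "\<lambda>s. (y, s)"]
    by (intro integrable_continuous_real) (force intro!: continuous_on_Pair)
  have "((\<lambda>y. integral {0..1} (\<lambda>s. h (y, s))) has_derivative
      (\<lambda>v. integral {0..1} (\<lambda>s. ?h' (y, s) (v, 0)))) (at y)" if y: "y \<in> Y" for y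
  proof -
    have "((\<lambda>y. integral (cbox 0 1) (\<lambda>s. h (y, s))) has_derivative
        blinfun_apply (integral (cbox 0 1) (H y))) (at y within Y)"
    proof (rule leibniz_rule[OF _ _ _ y assms(2)])
      show "((\<lambda>y. h (y, s)) has_derivative blinfun_apply (H y s)) (at y within Y)" if "y \<in> Y" for y s
        using d1[OF that] H[OF that] has_derivative_at_withinI by metis
    qed (use int contH in \<open>auto simp: cbox_interval\<close>)
    moreover have "blinfun_apply (integral {0..1} (H y)) = (\<lambda>v. integral {0..1} (\<lambda>s. ?h' (y, s) (v, 0)))"
    proof
      fix v
      have "blinfun_apply (integral {0..1} (H y)) v = integral {0..1} (\<lambda>s. blinfun_apply (H y s) v)"
        by (rule blinfun_apply_integral[OF intH[OF y]])
      then show "blinfun_apply (integral {0..1} (H y)) v = integral {0..1} (\<lambda>s. ?h' (y, s) (v, 0))"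
        by (simp add: H[OF y])
    qed
    ultimately show ?thesis using at_within_open[OF y assms(1)] by (simp add: cbox_interval)
  qed
  moreover have "Ck_on n Y (\<lambda>y. integral {0..1} (\<lambda>s. ?h' (y, s) (v, 0)))" for v
    using Suc.IH[of "\<lambda>z. ?h' z (v, 0)"] Ck_on_SucD(2)[OF Suc.prems] .
  ultimately show ?case by (rule Ck_on_SucI[OF assms(1)])
qed

lemma smooth_on_const: "open S \<Longrightarrow> smooth_on S (\<lambda>x. c)"
  by (simp add: smooth_on_def Ck_on_const)

lemma smooth_on_bounded_linear: "open S \<Longrightarrow> bounded_linear T \<Longrightarrow> smooth_on S T"
  by (simp add: smooth_on_def Ck_on_bounded_linear)

lemma smooth_on_ident: "open S \<Longrightarrow> smooth_on S (\<lambda>x. x)"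
  using smooth_on_bounded_linear[OF _ bounded_linear_ident] .

lemma smooth_on_add: "open S \<Longrightarrow> smooth_on S f \<Longrightarrow> smooth_on S g \<Longrightarrow> smooth_on S (\<lambda>x. f x + g x)"
  by (simp add: smooth_on_def Ck_on_add)

lemma smooth_on_mult:
  fixes f g :: "'a::euclidean_space \<Rightarrow> real"
  shows "open S \<Longrightarrow> smooth_on S f \<Longrightarrow> smooth_on S g \<Longrightarrow> smooth_on S (\<lambda>x. f x * g x)"
  using Ck_on_scaleR[of S _ f g] by (simp add: smooth_on_def)

lemma smooth_on_bounded_linear_comp:
  "open S \<Longrightarrow> bounded_linear T \<Longrightarrow> smooth_on S f \<Longrightarrow> smooth_on S (\<lambda>x. T (f x))"
  by (simp add: smooth_on_def Ck_on_bounded_linear_comp)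

lemma smooth_on_minus: "open S \<Longrightarrow> smooth_on S f \<Longrightarrow> smooth_on S (\<lambda>x. - f x)"
  using smooth_on_bounded_linear_comp[OF _ bounded_linear_minus[OF bounded_linear_ident]] .

lemma smooth_on_diff: "open S \<Longrightarrow> smooth_on S f \<Longrightarrow> smooth_on S g \<Longrightarrow> smooth_on S (\<lambda>x. f x - g x)"
  using smooth_on_add[of S f "\<lambda>x. - g x"] smooth_on_minus[of S g] by simp

lemma smooth_on_Pair:
  assumes "open S" "smooth_on S f" "smooth_on S g"
  shows "smooth_on S (\<lambda>x. (f x, g x))"
proof -
  have "smooth_on S (\<lambda>x. (f x, 0) + (0, g x))"
    by (intro smooth_on_add assms(1) smooth_on_bounded_linear_comp[where T = "\<lambda>u. (u, 0)"]
        smooth_on_bounded_linear_comp[where T = "\<lambda>u. (0, u)"] assms bounded_linear_Pair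
        bounded_linear_ident bounded_linear_zero)
  then show ?thesis by simp
qed

lemma smooth_on_compose:
  fixes g :: "'a::euclidean_space \<Rightarrow> 'b::euclidean_space"
  shows "open S \<Longrightarrow> smooth_on T f \<Longrightarrow> smooth_on S g \<Longrightarrow> (\<And>x. x \<in> S \<Longrightarrow> g x \<in> T) \<Longrightarrow>
    smooth_on S (\<lambda>x. f (g x))"
  by (simp add: smooth_on_def Ck_on_compose[where T = T])

lemma smooth_on_power:
  fixes f :: "'a::euclidean_space \<Rightarrow> real"
  shows "open S \<Longrightarrow> smooth_on S f \<Longrightarrow> smooth_on S (\<lambda>x. f x ^ n)"
  by (induction n) (simp_all add: smooth_on_const smooth_on_mult)

lemma smooth_on_cong: "open S \<Longrightarrow> (\<And>x. x \<in> S \<Longrightarrow> f x = g x) \<Longrightarrow> smooth_on S f \<Longrightarrow> smooth_on S g"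
  unfolding smooth_on_def by (meson Ck_on_cong)

lemma smooth_on_imp_continuous_on: "smooth_on S f \<Longrightarrow> continuous_on S f"
  unfolding smooth_on_def by (meson Ck_on_imp_continuous_on)

lemma smooth_on_has_derivative:
  "smooth_on S f \<Longrightarrow> x \<in> S \<Longrightarrow> (f has_derivative frechet_derivative f (at x)) (at x)"
  unfolding smooth_on_def by (meson Ck_on_SucD(1))

lemma smooth_on_frechet_derivative:
  "smooth_on S f \<Longrightarrow> smooth_on S (\<lambda>x. frechet_derivative f (at x) v)"
  using Ck_on_SucD(2)[of _ S f v] by (auto simp: smooth_on_def simp del: Ck_on.simps)

lemma Ck_on_SucI_real:
  fixes f :: "real \<Rightarrow> real"
  assumes "open S" "\<And>x. x \<in> S \<Longrightarrow> (f has_real_derivative f' x) (at x)" "Ck_on n S f'"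
  shows "Ck_on (Suc n) S f"
proof (rule Ck_on_SucI[OF assms(1)])
  show "(f has_derivative (*) (f' x)) (at x)" if "x \<in> S" for x
    using assms(2)[OF that] by (simp add: has_field_derivative_def)
  show "Ck_on n S (\<lambda>x. f' x * v)" for v
    using Ck_on_scaleR[OF assms(1) assms(3) Ck_on_const[OF assms(1)], of v] by simp
qed

lemma smooth_on_has_real_derivative:
  fixes f :: "real \<Rightarrow> real"
  assumes "smooth_on S f" "x \<in> S"
  shows "(f has_real_derivative deriv f x) (at x)"
  using smooth_on_has_derivative[OF assms]
  by (metis DERIV_imp_deriv differentiable_def real_differentiable_def)

lemma smooth_on_deriv:
  fixes f :: "real \<Rightarrow> real"
  assumes "open S" "smooth_on S f"
  shows "smooth_on S (deriv f)"
proof (rule smooth_on_cong[OF assms(1) _ smooth_on_frechet_derivative[OF assms(2), of 1]])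
  fix x assume "x \<in> S"
  then have "(f has_derivative (*) (deriv f x)) (at x)"
    using smooth_on_has_real_derivative[OF assms(2)] by (simp add: has_field_derivative_def)
  then show "frechet_derivative f (at x) 1 = deriv f x"
    by (metis frechet_derivative_at mult.right_neutral)
qed

text \<open>The derivative of a power is a multiple of another power, so the induction on the order must allow every
  exponent. Square roots, roots and reciprocals of positive functions are all instances.\<close>

lemma smooth_on_powr_real: "smooth_on {0<..} (\<lambda>x::real. x powr r)"
  unfolding smooth_on_def
proof
  show "Ck_on n {0<..} (\<lambda>x::real. x powr r)" for n
  proof (induction n arbitrary: r)
    case 0
    then show ?case by (auto intro!: continuous_intros)
  next
    case (Suc n)
    show ?case
    proof (rule Ck_on_SucI_real)
      show "((\<lambda>x. x powr r) has_real_derivative r * x powr (r - 1)) (at x)" if "x \<in> {0<..}" for x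
        using that by (intro has_real_derivative_powr) auto
      show "Ck_on n {0<..} (\<lambda>x. r * x powr (r - 1))"
        using Ck_on_scaleR[OF _ Ck_on_const Suc.IH, of r] by simp
    qed simp
  qed
qed

lemma smooth_on_sin_cos_real: "smooth_on UNIV (sin :: real \<Rightarrow> real)" "smooth_on UNIV (cos :: real \<Rightarrow> real)"
proof -
  have "Ck_on n UNIV (sin :: real \<Rightarrow> real) \<and> Ck_on n UNIV (cos :: real \<Rightarrow> real)" for n
  proof (induction n)
    case 0
    then show ?case by (auto intro!: continuous_intros)
  next
    case (Suc n)
    have "Ck_on n UNIV (\<lambda>x::real. - sin x)"
      using Ck_on_bounded_linear_comp[OF _ bounded_linear_minus[OF bounded_linear_ident]] Suc by auto
    then show ?case
      using Suc by (auto intro!: Ck_on_SucI_real[OF _ DERIV_sin] Ck_on_SucI_real[OF _ DERIV_cos] simp del: Ck_on.simps)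
  qed
  then show "smooth_on UNIV (sin :: real \<Rightarrow> real)" "smooth_on UNIV (cos :: real \<Rightarrow> real)"
    by (auto simp: smooth_on_def)
qed

context
  fixes S :: "'a::euclidean_space set" and f :: "'a \<Rightarrow> real"
  assumes S: "open S" and f: "smooth_on S f"
begin

lemma smooth_on_sin: "smooth_on S (\<lambda>x. sin (f x))"
  by (rule smooth_on_compose[OF S smooth_on_sin_cos_real(1) f]) simp

lemma smooth_on_cos: "smooth_on S (\<lambda>x. cos (f x))"
  by (rule smooth_on_compose[OF S smooth_on_sin_cos_real(2) f]) simp

lemma smooth_on_powr:
  assumes "\<And>x. x \<in> S \<Longrightarrow> f x > 0"
  shows "smooth_on S (\<lambda>x. f x powr r)"
  by (rule smooth_on_compose[OF S smooth_on_powr_real f]) (simp add: assms)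

lemma smooth_on_sqrt:
  assumes "\<And>x. x \<in> S \<Longrightarrow> f x > 0"
  shows "smooth_on S (\<lambda>x. sqrt (f x))"
  by (rule smooth_on_cong[OF S _ smooth_on_powr[where r = "1/2"]]) (auto simp: assms powr_half_sqrt less_imp_le)

lemma smooth_on_root:
  assumes "\<And>x. x \<in> S \<Longrightarrow> f x > 0" "n > 0"
  shows "smooth_on S (\<lambda>x. root n (f x))"
  by (rule smooth_on_cong[OF S _ smooth_on_powr[where r = "1/n"]]) (use assms in \<open>auto simp: root_powr_inverse less_imp_le\<close>)

lemma smooth_on_divide:
  assumes "\<And>x. x \<in> S \<Longrightarrow> f x > 0" "smooth_on S g"
  shows "smooth_on S (\<lambda>x. g x / f x)"
proof (rule smooth_on_cong[OF S _ smooth_on_mult[OF S assms(2) smooth_on_powr[where r = "-1"]]])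
  show "g x * f x powr - 1 = g x / f x" if "x \<in> S" for x
    using assms(1)[OF that] by (simp add: powr_minus field_simps)
qed (simp add: assms)

end

lemmas smooth_intros = smooth_on_const smooth_on_ident smooth_on_add smooth_on_mult smooth_on_minus
  smooth_on_diff smooth_on_Pair smooth_on_power smooth_on_sin smooth_on_cos smooth_on_sqrt
  smooth_on_root smooth_on_divide smooth_on_powr
  smooth_on_bounded_linear_comp[OF _ bounded_linear_fst]
  smooth_on_bounded_linear_comp[OF _ bounded_linear_snd]

text \<open>The smooth inverse function theorem for a map whose inverse \<open>g\<close> is already known: \<open>R x\<close> is the inverse
  of the derivative at \<open>x\<close>. From \<open>Dg(y) = R (g y)\<close>, if \<open>g\<close> is of class \<open>n\<close> then so is its derivative, and
  the order climbs by one at each step.\<close>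

lemma smooth_on_left_inverse:
  fixes T g :: "'a::euclidean_space \<Rightarrow> 'a"
  assumes S: "open S" and T: "\<And>x. x \<in> S \<Longrightarrow> (T has_derivative T' x) (at x)"
    and inv: "\<And>x. x \<in> S \<Longrightarrow> g (T x) = x"
    and R: "\<And>x v. x \<in> S \<Longrightarrow> T' x (R x v) = v" "\<And>v. smooth_on S (\<lambda>x. R x v)"
  shows "open (T ` S)" "smooth_on (T ` S) g"
proof -
  have contT: "continuous_on S T"
    using T has_derivative_continuous by (intro continuous_at_imp_continuous_on) blast
  have "inj_on T S" using inv by (metis inj_on_inverseI)
  then show opn: "open (T ` S)" using invariance_of_domain[OF contT S] by blast
  have der: "(g has_derivative R (g y)) (at y)" if "y \<in> T ` S" for y
    using that R(1) inv by (auto intro!: has_derivative_inverse_strong[OF S _ contT inv T])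
  have "Ck_on n (T ` S) g" for n
  proof (induction n)
    case 0
    then show ?case
      using has_derivative_continuous[OF der] by (simp add: continuous_at_imp_continuous_on)
  next
    case (Suc n)
    have "Ck_on n (T ` S) (\<lambda>y. R (g y) v)" for v
      using R(2) by (intro Ck_on_compose[OF opn Suc, where T = S]) (auto simp: inv smooth_on_def)
    with der show ?case by (intro Ck_on_SucI[OF opn])
  qed
  then show "smooth_on (T ` S) g" by (simp add: smooth_on_def)
qed

section \<open>The incomplete elliptic integral and the amplitude\<close>

lemma one_minus_mult_sin2_pos:
  fixes m t :: real
  assumes "0 \<le> m" "m < 1"
  shows "1 - m * (sin t)\<^sup>2 > 0"
proof -
  have "m * (sin t)\<^sup>2 \<le> m * 1" using assms by (intro mult_left_mono) (simp_all add: abs_square_le_1)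
  then show ?thesis using assms by simp
qed

lemma one_minus_k2_sin2_pos:
  fixes k t :: real
  assumes "k \<in> {-1<..<1}"
  shows "1 - k\<^sup>2 * (sin t)\<^sup>2 > 0"
  using assms by (intro one_minus_mult_sin2_pos) (auto simp: abs_square_less_1)

lemma continuous_on_ellF_integrand:
  "k \<in> {-1<..<1} \<Longrightarrow> continuous_on A (\<lambda>t. 1 / sqrt (1 - k\<^sup>2 * (sin t)\<^sup>2))"
  by (intro continuous_intros) (use one_minus_k2_sin2_pos[of k] in \<open>auto simp: less_le\<close>)

lemma ellF_0: "ellF 0 k = 0"
  by (simp add: ellF_def)

lemma has_real_derivative_ellF:
  assumes "k \<in> {-1<..<1}"
  shows "((\<lambda>\<phi>. ellF \<phi> k) has_real_derivative 1 / sqrt (1 - k\<^sup>2 * (sin \<phi>)\<^sup>2)) (at \<phi>)"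
proof -
  let ?a = "min 0 \<phi> - 1" and ?b = "max 0 \<phi> + 1"
  have "((\<lambda>u. LBINT t=ereal 0..ereal u. 1 / sqrt (1 - k\<^sup>2 * (sin t)\<^sup>2)) has_vector_derivative
      1 / sqrt (1 - k\<^sup>2 * (sin \<phi>)\<^sup>2)) (at \<phi> within {?a..?b})"
    by (intro interval_integral_FTC2 continuous_on_ellF_integrand assms) auto
  moreover have "at \<phi> within {?a..?b} = at \<phi>"
    by (rule at_within_Icc_at) (auto simp: min_def max_def)
  ultimately show ?thesis
    unfolding ellF_def by (simp add: has_real_derivative_iff_has_vector_derivative)
qed

text \<open>Rescaling to a fixed interval turns the variable upper limit into a parameter of the integrand, so
  smoothness in \<open>\<phi>\<close> and in \<open>k\<close> both follow from differentiation under the integral sign.\<close>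

lemma ellF_eq_integral_unit_interval:
  assumes "k \<in> {-1<..<1}"
  shows "ellF \<phi> k = \<phi> * integral {0..1} (\<lambda>s. 1 / sqrt (1 - k\<^sup>2 * (sin (\<phi> * s))\<^sup>2))"
proof -
  let ?f = "\<lambda>t. 1 / sqrt (1 - k\<^sup>2 * (sin t)\<^sup>2)"
  have "((\<lambda>s. \<phi> * ?f (\<phi> * s)) has_integral ellF (\<phi> * 1) k - ellF (\<phi> * 0) k) {0..1}"
  proof (rule fundamental_theorem_of_calculus)
    show "((\<lambda>s. ellF (\<phi> * s) k) has_vector_derivative \<phi> * ?f (\<phi> * s)) (at s within {0..1})" for s
    proof -
      have "((\<lambda>s. ellF (\<phi> * s) k) has_real_derivative ?f (\<phi> * s) * \<phi>) (at s)"
        by (rule DERIV_chain2[OF has_real_derivative_ellF[OF assms]]) (auto intro!: derivative_eq_intros)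
      then show ?thesis
        by (simp add: has_real_derivative_iff_has_vector_derivative mult.commute has_vector_derivative_at_within)
    qed
  qed simp
  then show ?thesis
    by (simp add: ellF_0 integral_unique flip: integral_mult_right)
qed

lemma smooth_on_ellF: "smooth_on (UNIV \<times> {-1<..<1}) (\<lambda>(\<phi>, k). ellF \<phi> k)"
proof -
  let ?Y = "UNIV \<times> {-1<..<1} :: (real \<times> real) set"
  let ?h = "\<lambda>z :: (real \<times> real) \<times> real. 1 / sqrt (1 - (snd (fst z))\<^sup>2 * (sin (fst (fst z) * snd z))\<^sup>2)"
  have opn: "open ?Y" "open (?Y \<times> (UNIV :: real set))" by (auto intro!: open_Times)
  have "smooth_on (?Y \<times> UNIV) ?h"
    by (intro smooth_intros opn real_sqrt_gt_zero one_minus_k2_sin2_pos) auto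
  then have "smooth_on ?Y (\<lambda>y. integral {0..1} (\<lambda>s. ?h (y, s)))"
    unfolding smooth_on_def by (intro allI Ck_on_integral) (auto intro!: opn convex_Times)
  then have "smooth_on ?Y (\<lambda>y. fst y * integral {0..1} (\<lambda>s. ?h (y, s)))"
    by (intro smooth_intros opn)
  then show ?thesis
    by (rule smooth_on_cong[OF opn(1), rotated]) (auto simp: ellF_eq_integral_unit_interval)
qed

text \<open>The integrand is at least \<open>1\<close>. This gives injectivity, and enough growth for surjectivity, at once.\<close>

lemma ellF_diff_ge:
  assumes "k \<in> {-1<..<1}" "\<phi> \<le> \<phi>'"
  shows "\<phi>' - \<phi> \<le> ellF \<phi>' k - ellF \<phi> k"
proof -
  have "ellF \<phi> k - \<phi> \<le> ellF \<phi>' k - \<phi>'"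
  proof (rule deriv_nonneg_imp_mono[of \<phi> \<phi>' "\<lambda>\<phi>. ellF \<phi> k - \<phi>"])
    show "((\<lambda>\<phi>. ellF \<phi> k - \<phi>) has_real_derivative 1 / sqrt (1 - k\<^sup>2 * (sin t)\<^sup>2) - 1) (at t)" for t
      by (intro derivative_intros has_real_derivative_ellF assms)
    show "0 \<le> 1 / sqrt (1 - k\<^sup>2 * (sin t)\<^sup>2) - 1" for t
      using one_minus_k2_sin2_pos[OF assms(1), of t] by (simp add: field_simps)
  qed (use assms in auto)
  then show ?thesis by simp
qed

lemma ellF_inj:
  assumes "k \<in> {-1<..<1}" "ellF \<phi> k = ellF \<phi>' k"
  shows "\<phi> = \<phi>'"
  using ellF_diff_ge[OF assms(1), of \<phi> \<phi>'] ellF_diff_ge[OF assms(1), of \<phi>' \<phi>] assms(2)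
  by linarith

lemma ellF_surj:
  assumes "k \<in> {-1<..<1}"
  obtains \<phi> where "ellF \<phi> k = u"
proof -
  have "isCont (\<lambda>\<phi>. ellF \<phi> k) t" for t
    using has_real_derivative_ellF[OF assms] by (rule DERIV_isCont)
  moreover have "ellF (- \<bar>u\<bar>) k \<le> u" "u \<le> ellF \<bar>u\<bar> k"
    using ellF_diff_ge[OF assms, of "- \<bar>u\<bar>" 0] ellF_diff_ge[OF assms, of 0 "\<bar>u\<bar>"] by (auto simp: ellF_0)
  ultimately have "\<exists>\<phi>. - \<bar>u\<bar> \<le> \<phi> \<and> \<phi> \<le> \<bar>u\<bar> \<and> ellF \<phi> k = u"
    by (intro IVT) auto
  then show ?thesis using that by blast
qed

lemma jacobi_am_ellF: "k \<in> {-1<..<1} \<Longrightarrow> jacobi_am (ellF \<phi> k) k = \<phi>"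
  unfolding jacobi_am_def by (rule the_equality[where a = \<phi>]) (simp, rule ellF_inj)

lemma ellF_jacobi_am: "k \<in> {-1<..<1} \<Longrightarrow> ellF (jacobi_am u k) k = u"
proof -
  assume k: "k \<in> {-1<..<1}"
  then obtain \<phi> where "ellF \<phi> k = u" by (rule ellF_surj)
  then show ?thesis using jacobi_am_ellF[OF k, of \<phi>] by simp
qed

text \<open>The symmetries \<open>t \<mapsto> \<pi> - t\<close> and \<open>t \<mapsto> t + \<pi>\<close> of the integrand, each used by noting that a suitable combination
  of values has derivative zero.\<close>

lemma ellF_add_2pi:
  assumes "k \<in> {-1<..<1}"
  shows "ellF (\<phi> + 2 * pi) k = ellF \<phi> k + 4 * ellK k"
proof -
  note D = has_real_derivative_ellF[OF assms]
  have "ellF (pi - pi / 2) k + ellF (pi / 2) k = ellF (pi - 0) k + ellF 0 k"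
  proof (rule DERIV_isconst_all[where f = "\<lambda>t. ellF (pi - t) k + ellF t k"])
    show "\<forall>t. ((\<lambda>t. ellF (pi - t) k + ellF t k) has_real_derivative 0) (at t)"
      by (auto intro!: derivative_eq_intros DERIV_chain2[OF D] D)
  qed
  then have pi: "ellF pi k = 2 * ellK k" by (simp add: ellF_0 ellK_def)
  have shift: "ellF (\<phi> + pi) k = ellF \<phi> k + 2 * ellK k" for \<phi>
  proof -
    have "ellF (\<phi> + pi) k - ellF \<phi> k = ellF (0 + pi) k - ellF 0 k"
    proof (rule DERIV_isconst_all[where f = "\<lambda>t. ellF (t + pi) k - ellF t k"])
      show "\<forall>t. ((\<lambda>t. ellF (t + pi) k - ellF t k) has_real_derivative 0) (at t)"
        by (auto intro!: derivative_eq_intros DERIV_chain2[OF D] D)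
    qed
    with pi show ?thesis by (simp add: ellF_0)
  qed
  show ?thesis using shift[of \<phi>] shift[of "\<phi> + pi"] by (simp add: algebra_simps)
qed

lemma jacobi_am_add_4K:
  assumes "k \<in> {-1<..<1}"
  shows "jacobi_am (u + 4 * ellK k) k = jacobi_am u k + 2 * pi"
  using jacobi_am_ellF[OF assms, of "jacobi_am u k + 2 * pi"]
  by (simp add: ellF_add_2pi[OF assms] ellF_jacobi_am[OF assms])

lemma has_real_derivative_jacobi_am:
  assumes "k \<in> {-1<..<1}"
  shows "((\<lambda>u. jacobi_am u k) has_real_derivative sqrt (1 - k\<^sup>2 * (sin (jacobi_am u k))\<^sup>2)) (at u)"
proof -
  define \<phi> where "\<phi> = jacobi_am u k"
  have "((\<lambda>u. jacobi_am u k) has_derivative (*) (sqrt (1 - k\<^sup>2 * (sin \<phi>)\<^sup>2))) (at (ellF \<phi> k))"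
  proof (rule has_derivative_inverse_strong[where f = "\<lambda>\<phi>. ellF \<phi> k" and x = \<phi>, OF open_UNIV UNIV_I])
    show "continuous_on UNIV (\<lambda>\<phi>. ellF \<phi> k)"
      using has_real_derivative_ellF[OF assms] by (meson DERIV_isCont continuous_at_imp_continuous_on)
    show "((\<lambda>\<phi>. ellF \<phi> k) has_derivative (*) (1 / sqrt (1 - k\<^sup>2 * (sin \<phi>)\<^sup>2))) (at \<phi>)"
      using has_real_derivative_ellF[OF assms] by (simp add: has_field_derivative_def)
  qed (use jacobi_am_ellF[OF assms] one_minus_k2_sin2_pos[OF assms, of \<phi>] in \<open>auto simp: fun_eq_iff\<close>)
  then show ?thesis
    by (simp add: \<phi>_def ellF_jacobi_am[OF assms] has_field_derivative_def)
qed

text \<open>The amplitude is the first component of the inverse of \<open>(\<phi>, k) \<mapsto> (ellF \<phi> k, k)\<close>. The derivative of that map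
  is triangular, hence its inverse can be written down.\<close>

lemma smooth_on_jacobi_am: "smooth_on (UNIV \<times> {-1<..<1}) (\<lambda>(u, k). jacobi_am u k)"
proof -
  let ?S = "UNIV \<times> {-1<..<1} :: (real \<times> real) set"
  let ?F = "\<lambda>z :: real \<times> real. ellF (fst z) (snd z)"
  let ?\<Delta> = "\<lambda>z :: real \<times> real. sqrt (1 - (snd z)\<^sup>2 * (sin (fst z))\<^sup>2)"
  define F\<^sub>k where "F\<^sub>k z = frechet_derivative ?F (at z) (0, 1)" for z
  have opn: "open ?S" by (auto intro!: open_Times)
  have smF: "smooth_on ?S ?F" using smooth_on_ellF by (simp add: case_prod_unfold)
  have pos: "?\<Delta> z > 0" if "z \<in> ?S" for z using one_minus_k2_sin2_pos that by auto
  have F': "(?F has_derivative (\<lambda>v. fst v / ?\<Delta> z + snd v * F\<^sub>k z)) (at z)" if z: "z \<in> ?S" for z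
  proof -
    let ?D = "frechet_derivative ?F (at z)"
    have D: "(?F has_derivative ?D) (at z)" by (rule smooth_on_has_derivative[OF smF z])
    then interpret bounded_linear ?D by (rule has_derivative_bounded_linear)
    have "((\<lambda>\<phi>. (\<phi>, snd z)) has_derivative (\<lambda>h. (h, 0))) (at (fst z))"
      by (auto intro!: derivative_eq_intros)
    from has_derivative_compose[OF this, of ?F ?D] D
    have D1: "((\<lambda>\<phi>. ellF \<phi> (snd z)) has_derivative (\<lambda>h. ?D (h, 0))) (at (fst z))" by simp
    have "((\<lambda>\<phi>. ellF \<phi> (snd z)) has_derivative (*) (1 / ?\<Delta> z)) (at (fst z))"
      using has_real_derivative_ellF[of "snd z" "fst z"] z unfolding has_field_derivative_def by auto
    from has_derivative_unique[OF D1 this] have "(\<lambda>h. ?D (h, 0)) = (*) (1 / ?\<Delta> z)" .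
    then have h: "?D (h, 0) = h / ?\<Delta> z" for h by (simp add: fun_eq_iff)
    have "?D = (\<lambda>v. fst v / ?\<Delta> z + snd v * F\<^sub>k z)"
    proof
      fix v :: "real \<times> real"
      have "v = (fst v, 0) + snd v *\<^sub>R (0, 1)" by (simp add: prod_eq_iff)
      then have "?D v = ?D (fst v, 0) + snd v *\<^sub>R ?D (0, 1)"
        using add[of "(fst v, 0)" "snd v *\<^sub>R (0, 1)"] scaleR[of "snd v" "(0, 1)"] by simp
      then show "?D v = fst v / ?\<Delta> z + snd v * F\<^sub>k z" by (simp add: h F\<^sub>k_def)
    qed
    with D show ?thesis by simp
  qed
  let ?T = "\<lambda>z. (?F z, snd z)" and ?g = "\<lambda>w. (jacobi_am (fst w) (snd w), snd w)"
  have "smooth_on (?T ` ?S) ?g"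
  proof (rule smooth_on_left_inverse(2)[OF opn])
    show "(?T has_derivative (\<lambda>v. (fst v / ?\<Delta> z + snd v * F\<^sub>k z, snd v))) (at z)" if "z \<in> ?S" for z
      by (intro has_derivative_Pair F' that) (auto intro!: derivative_eq_intros)
    show "((fst ((fst v - snd v * F\<^sub>k z) * ?\<Delta> z, snd v)) / ?\<Delta> z
        + snd ((fst v - snd v * F\<^sub>k z) * ?\<Delta> z, snd v) * F\<^sub>k z, snd ((fst v - snd v * F\<^sub>k z) * ?\<Delta> z, snd v)) = v"
      if "z \<in> ?S" for z v using pos[OF that] by (simp add: prod_eq_iff)
    show "smooth_on ?S (\<lambda>z. ((fst v - snd v * F\<^sub>k z) * ?\<Delta> z, snd v))" for v
      unfolding F\<^sub>k_def
      by (intro smooth_intros smooth_on_frechet_derivative smF opn) (use one_minus_k2_sin2_pos in auto)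
  qed (auto simp: jacobi_am_ellF)
  moreover have "?T ` ?S = ?S"
  proof -
    have "(u, k) \<in> ?T ` ?S" if "k \<in> {-1<..<1}" for u k
      using that ellF_jacobi_am[OF that, of u] by (intro image_eqI[of _ _ "(jacobi_am u k, k)"]) auto
    then show ?thesis by auto
  qed
  ultimately have "smooth_on ?S (\<lambda>w. fst (?g w))"
    using smooth_on_bounded_linear_comp[OF opn bounded_linear_fst] by metis
  then show ?thesis by (simp add: case_prod_unfold)
qed

section \<open>The complete elliptic integral\<close>

lemma smooth_on_compose_ellK:
  assumes "open S" "smooth_on S f" "\<And>x. x \<in> S \<Longrightarrow> f x \<in> {-1<..<1}"
  shows "smooth_on S (\<lambda>x. ellK (f x))"
proof -
  have "smooth_on S (\<lambda>x. case (pi / 2, f x) of (\<phi>, k) \<Rightarrow> ellF \<phi> k)"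
    by (rule smooth_on_compose[OF assms(1) smooth_on_ellF]) (auto intro!: smooth_intros assms simp: assms(3)[simplified])
  then show ?thesis by (simp add: ellK_def)
qed

lemma smooth_on_compose_jacobi_am:
  assumes "open S" "smooth_on S f" "smooth_on S g" "\<And>x. x \<in> S \<Longrightarrow> g x \<in> {-1<..<1}"
  shows "smooth_on S (\<lambda>x. jacobi_am (f x) (g x))"
proof -
  have "smooth_on S (\<lambda>x. case (f x, g x) of (u, k) \<Rightarrow> jacobi_am u k)"
    by (rule smooth_on_compose[OF assms(1) smooth_on_jacobi_am]) (auto intro!: smooth_intros assms simp: assms(4)[simplified])
  then show ?thesis by simp
qed

lemma has_integral_ellK:
  assumes "k \<in> {-1<..<1}"
  shows "((\<lambda>t. 1 / sqrt (1 - k\<^sup>2 * (sin t)\<^sup>2)) has_integral ellK k) {0..pi / 2}"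
proof -
  have "((\<lambda>t. 1 / sqrt (1 - k\<^sup>2 * (sin t)\<^sup>2)) has_integral ellF (pi / 2) k - ellF 0 k) {0..pi / 2}"
    using has_real_derivative_ellF[OF assms]
    by (intro fundamental_theorem_of_calculus)
      (auto simp: has_real_derivative_iff_has_vector_derivative has_vector_derivative_at_within)
  then show ?thesis by (simp add: ellF_0 ellK_def)
qed

lemma ellK_0: "ellK 0 = pi / 2"
proof -
  have "((\<lambda>t. 1) has_integral ellK 0) {0..pi / 2}" using has_integral_ellK[of 0] by simp
  moreover have "((\<lambda>t. 1::real) has_integral pi / 2) {0..pi / 2}"
    using has_integral_const_real[of "1::real" 0 "pi / 2"] by simp
  ultimately show ?thesis by (rule has_integral_unique)
qed

lemma ellK_ge: "k \<in> {-1<..<1} \<Longrightarrow> pi / 2 \<le> ellK k"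
  using ellF_diff_ge[of k 0 "pi / 2"] by (simp add: ellF_0 ellK_def)

lemma ellK_pos: "k \<in> {-1<..<1} \<Longrightarrow> ellK k > 0"
  using ellK_ge[of k] pi_gt_zero by linarith

lemma ellK_le:
  assumes "k \<in> {-1<..<1}"
  shows "ellK k \<le> pi / (2 * sqrt (1 - k\<^sup>2))"
proof -
  have "ellK k \<le> (pi / 2 - 0) *\<^sub>R (1 / sqrt (1 - k\<^sup>2))"
  proof (rule has_integral_le[OF has_integral_ellK[OF assms]])
    show "((\<lambda>_. 1 / sqrt (1 - k\<^sup>2)) has_integral (pi / 2 - 0) *\<^sub>R (1 / sqrt (1 - k\<^sup>2))) {0..pi / 2}"
      using has_integral_const_real[of "1 / sqrt (1 - k\<^sup>2)" 0 "pi / 2"] by simp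
    show "1 / sqrt (1 - k\<^sup>2 * (sin t)\<^sup>2) \<le> 1 / sqrt (1 - k\<^sup>2)" for t
    proof -
      have "k\<^sup>2 * (sin t)\<^sup>2 \<le> k\<^sup>2 * 1"
        by (intro mult_left_mono) (simp_all add: abs_square_le_1)
      moreover have "k\<^sup>2 < 1" using assms by (simp add: abs_square_less_1 abs_less_iff)
      ultimately show ?thesis by (intro divide_left_mono) auto
    qed
  qed
  then show ?thesis by (simp add: field_simps)
qed

text \<open>The logarithmic divergence at \<open>k = 1\<close>: with \<open>c\<^sup>2 = 1 - k\<^sup>2\<close>, the bound \<open>cos t \<le> \<pi>/2 - t\<close> gives
  \<open>1 - k\<^sup>2 sin\<^sup>2 t = c\<^sup>2 + k\<^sup>2 cos\<^sup>2 t \<le> (c + \<pi>/2 - t)\<^sup>2\<close>, and the reciprocal of the right-hand root integrates to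
  a logarithm.\<close>

lemma ellK_ge_ln:
  assumes "k \<in> {-1<..<1}"
  shows "ellK k \<ge> - ln (sqrt (1 - k\<^sup>2))"
proof -
  define c where "c = sqrt (1 - k\<^sup>2)"
  have k: "k\<^sup>2 < 1" using assms by (simp add: abs_square_less_1 abs_less_iff)
  then have c: "c > 0" "c\<^sup>2 = 1 - k\<^sup>2" by (auto simp: c_def)
  have "((\<lambda>t. 1 / (c + pi / 2 - t)) has_integral - ln (c + pi / 2 - pi / 2) - - ln (c + pi / 2 - 0)) {0..pi / 2}"
  proof (rule fundamental_theorem_of_calculus)
    fix t assume "t \<in> {0..pi / 2}"
    then have "((\<lambda>t. - ln (c + pi / 2 - t)) has_real_derivative 1 / (c + pi / 2 - t)) (at t)"
      using c by (auto intro!: derivative_eq_intros)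
    then show "((\<lambda>t. - ln (c + pi / 2 - t)) has_vector_derivative 1 / (c + pi / 2 - t)) (at t within {0..pi / 2})"
      by (simp add: has_real_derivative_iff_has_vector_derivative has_vector_derivative_at_within)
  qed simp
  then have "- ln (c + pi / 2 - pi / 2) - - ln (c + pi / 2 - 0) \<le> ellK k"
  proof (rule has_integral_le[OF _ has_integral_ellK[OF assms]])
    fix t assume t': "t \<in> {0..pi / 2}"
    then have t: "0 \<le> t \<and> t \<le> pi / 2" by simp
    have "cos t \<le> pi / 2 - t" using sin_x_le_x[of "pi / 2 - t"] t by (simp add: cos_sin_eq)
    moreover have "0 \<le> cos t" using t by (intro cos_ge_zero) auto
    ultimately have "(cos t)\<^sup>2 \<le> (pi / 2 - t)\<^sup>2" by (intro power_mono)
    moreover have "k\<^sup>2 * (cos t)\<^sup>2 \<le> 1 * (cos t)\<^sup>2" using k by (intro mult_right_mono) auto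
    moreover have "0 \<le> c * (pi / 2 - t)" using c t by (intro mult_nonneg_nonneg) auto
    moreover have "1 - k\<^sup>2 * (sin t)\<^sup>2 = c\<^sup>2 + k\<^sup>2 * (cos t)\<^sup>2"
      unfolding c(2) sin_squared_eq by (simp add: algebra_simps)
    ultimately have "1 - k\<^sup>2 * (sin t)\<^sup>2 \<le> (c + (pi / 2 - t))\<^sup>2"
      unfolding power2_sum by linarith
    then have "sqrt (1 - k\<^sup>2 * (sin t)\<^sup>2) \<le> c + pi / 2 - t"
      using c t by (intro real_le_lsqrt) (auto simp: algebra_simps)
    moreover have "0 < sqrt (1 - k\<^sup>2 * (sin t)\<^sup>2)" using one_minus_k2_sin2_pos[OF assms] by simp
    ultimately show "1 / (c + pi / 2 - t) \<le> 1 / sqrt (1 - k\<^sup>2 * (sin t)\<^sup>2)"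
      using c t by (intro divide_left_mono mult_pos_pos) auto
  qed
  moreover have "ln (c + pi / 2) \<ge> 0" using c pi_gt3 by (intro ln_ge_zero) auto
  ultimately show ?thesis unfolding c_def by simp
qed

text \<open>Write \<open>d = sqrt (1 - k\<^sup>2 sin\<^sup>2 t)\<close>. Since \<open>d \<le> 1\<close>, the derivative \<open>k sin\<^sup>2 t / d\<^sup>3\<close> of the integrand exceeds half of
  \<open>k / d\<close> by at least \<open>k (sin\<^sup>2 t - 1/2) / d\<^sup>3\<close>. The factors \<open>sin\<^sup>2 t - 1/2\<close> and \<open>1 / d\<^sup>3\<close> increase together, so
  replacing \<open>d\<close> by its value \<open>\<delta>\<close> at \<open>sin\<^sup>2 t = 1/2\<close> decreases the product (Chebyshev's argument); what is left has mean
  zero on the quarter period.\<close>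

lemma deriv_ellK_ge:
  assumes "k \<in> {0..<1}"
  shows "deriv ellK k \<ge> k / 2 * ellK k"
proof -
  let ?J = "{-1<..<1::real}"
  let ?\<Delta> = "\<lambda>k t. sqrt (1 - k\<^sup>2 * (sin t)\<^sup>2)"
  let ?f' = "\<lambda>k t. k * (sin t)\<^sup>2 / ?\<Delta> k t ^ 3"
  have pos: "?\<Delta> k t > 0" if "k \<in> ?J" for k t using one_minus_k2_sin2_pos[OF that] by simp
  have k: "k \<in> ?J" "k \<ge> 0" using assms by auto
  have cont: "continuous_on (?J \<times> cbox 0 (pi / 2)) (\<lambda>(k, t). ?f' k t)"
    unfolding case_prod_unfold
    by (intro continuous_intros) (use one_minus_k2_sin2_pos in \<open>force simp: less_le\<close>)
  have cont1: "continuous_on {0..pi / 2} (?f' k)"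
    by (intro continuous_intros) (use one_minus_k2_sin2_pos[OF k(1)] in \<open>auto simp: less_le\<close>)
  have "((\<lambda>k. integral (cbox 0 (pi / 2)) (\<lambda>t. 1 / ?\<Delta> k t)) has_field_derivative
      integral (cbox 0 (pi / 2)) (?f' k)) (at k within ?J)"
  proof (rule leibniz_rule_field_derivative[OF _ _ cont k(1)])
    fix k assume k: "k \<in> ?J"
    show "(\<lambda>t. 1 / ?\<Delta> k t) integrable_on cbox 0 (pi / 2)"
      using has_integral_ellK[OF k] by (auto simp: cbox_interval)
    fix t
    show "((\<lambda>k. 1 / ?\<Delta> k t) has_field_derivative ?f' k t) (at k within ?J)"
      using one_minus_k2_sin2_pos[OF k, of t]
      by (auto intro!: derivative_eq_intros simp: field_simps power2_eq_square power3_eq_cube)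
  qed simp
  then have "((\<lambda>k. integral {0..pi / 2} (\<lambda>t. 1 / ?\<Delta> k t)) has_real_derivative
      integral {0..pi / 2} (?f' k)) (at k)"
    using at_within_open[OF k(1)] by (simp add: cbox_interval)
  then have "(ellK has_real_derivative integral {0..pi / 2} (?f' k)) (at k)"
    by (rule has_field_derivative_transform_within_open[OF _ _ k(1)])
      (use has_integral_ellK in \<open>auto simp: integral_unique\<close>)
  then have D: "deriv ellK k = integral {0..pi / 2} (?f' k)" by (rule DERIV_imp_deriv)
  let ?\<delta> = "sqrt (1 - k\<^sup>2 / 2)"
  have k2: "k\<^sup>2 < 1" using k by (simp add: abs_square_less_1 abs_less_iff)
  then have \<delta>: "?\<delta> > 0" by auto
  have "((\<lambda>t. k / ?\<delta> ^ 3 * ((sin t)\<^sup>2 - 1 / 2)) has_integral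
      k / ?\<delta> ^ 3 * (- sin (pi / 2) * cos (pi / 2) / 2 - - sin 0 * cos 0 / 2)) {0..pi / 2}"
  proof (rule has_integral_mult_right, rule fundamental_theorem_of_calculus)
    fix t :: real
    have "((\<lambda>t. - sin t * cos t / 2) has_real_derivative (sin t)\<^sup>2 - 1 / 2) (at t)"
      by (auto intro!: derivative_eq_intros simp: cos_squared_eq power2_eq_square[symmetric] field_simps)
    then show "((\<lambda>t. - sin t * cos t / 2) has_vector_derivative (sin t)\<^sup>2 - 1 / 2) (at t within {0..pi / 2})"
      by (simp add: has_real_derivative_iff_has_vector_derivative has_vector_derivative_at_within)
  qed simp
  then have "((\<lambda>t. k / 2 * (1 / ?\<Delta> k t) + k / ?\<delta> ^ 3 * ((sin t)\<^sup>2 - 1 / 2)) has_integral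
      k / 2 * ellK k + 0) {0..pi / 2}"
    by (intro has_integral_add has_integral_mult_right has_integral_ellK k) simp
  then have "k / 2 * ellK k + 0 \<le> integral {0..pi / 2} (?f' k)"
  proof (rule has_integral_le[OF _ integrable_integral])
    show "?f' k integrable_on {0..pi / 2}" by (rule integrable_continuous_real[OF cont1])
    fix t
    let ?d = "?\<Delta> k t"
    have d: "?d > 0" "?d \<le> 1" using pos[OF k(1)] by auto
    have "1 / ?d \<le> 1 / ?d ^ 3"
      using d power_decreasing[of 1 3 ?d] by (intro divide_left_mono) auto
    then have "k / 2 * (1 / ?d) \<le> k / 2 * (1 / ?d ^ 3)" using k by (intro mult_left_mono) auto
    moreover have "k * (((sin t)\<^sup>2 - 1 / 2) * (1 / ?\<delta> ^ 3)) \<le> k * (((sin t)\<^sup>2 - 1 / 2) * (1 / ?d ^ 3))"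
    proof (rule mult_left_mono[OF _ k(2)])
      consider "(sin t)\<^sup>2 \<ge> 1 / 2" | "(sin t)\<^sup>2 \<le> 1 / 2" by linarith
      then show "((sin t)\<^sup>2 - 1 / 2) * (1 / ?\<delta> ^ 3) \<le> ((sin t)\<^sup>2 - 1 / 2) * (1 / ?d ^ 3)"
      proof cases
        case 1
        then have "?d \<le> ?\<delta>" using mult_left_mono[OF 1, of "k\<^sup>2"] by simp
        then show ?thesis using 1 d \<delta> by (intro mult_left_mono divide_left_mono power_mono) auto
      next
        case 2
        then have "?\<delta> \<le> ?d" using mult_left_mono[OF 2, of "k\<^sup>2"] by simp
        then show ?thesis using 2 d \<delta> by (intro mult_left_mono_neg divide_left_mono power_mono) auto
      qed
    qed
    ultimately show "k / 2 * (1 / ?d) + k / ?\<delta> ^ 3 * ((sin t)\<^sup>2 - 1 / 2) \<le> ?f' k t"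
      by (simp add: algebra_simps add_divide_distrib diff_divide_distrib)
  qed
  then show ?thesis by (simp add: D)
qed

section \<open>Frequency, modulus and parameters\<close>

lemma quartic_pos: "k^4 - k\<^sup>2 + 1 > (0::real)"
proof -
  have "k^4 - k\<^sup>2 + 1 = (k\<^sup>2 - 1 / 2)\<^sup>2 + 3 / 4" by (simp add: power2_eq_square power4_eq_xxxx algebra_simps)
  then show ?thesis using zero_le_power2[of "k\<^sup>2 - 1 / 2"] by linarith
qed

lemma k2_less_1: "k \<in> {0<..<1} \<Longrightarrow> 0 < k\<^sup>2" "k \<in> {0<..<1} \<Longrightarrow> k\<^sup>2 < (1::real)"
  by (auto simp: abs_square_less_1)

lemma sqrt_quartic_bounds:
  assumes "k \<in> {0<..<1::real}"
  shows "1 - k\<^sup>2 / 2 < sqrt (k^4 - k\<^sup>2 + 1)" "sqrt (k^4 - k\<^sup>2 + 1) < 1" "1 - 2 * k\<^sup>2 < sqrt (k^4 - k\<^sup>2 + 1)"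
proof -
  define m where "m = k\<^sup>2"
  have m: "0 < m" "m < 1" "k^4 = m * m"
    using k2_less_1[OF assms] by (auto simp: m_def power4_eq_xxxx power2_eq_square)
  have mm: "m * m < m" "0 < m * m" using mult_strict_right_mono[OF m(2,1)] m(1) by simp_all
  have "(1 - m / 2)\<^sup>2 < m * m - m + 1" "(1 - 2 * m)\<^sup>2 < m * m - m + 1"
    using mm m(2) by (simp_all add: power2_eq_square field_simps)
  then show "1 - k\<^sup>2 / 2 < sqrt (k^4 - k\<^sup>2 + 1)" "1 - 2 * k\<^sup>2 < sqrt (k^4 - k\<^sup>2 + 1)"
    unfolding m(3) m_def[symmetric] by (simp_all only: real_less_rsqrt)
  show "sqrt (k^4 - k\<^sup>2 + 1) < 1" unfolding m(3) m_def[symmetric] using mm by simp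
qed

lemma freq_0: "freq 0 L = 4 * pi\<^sup>2 / L\<^sup>2"
  by (simp add: freq_def ellK_0 power_divide)

lemma smooth_on_compose_freq:
  assumes "open S" "smooth_on S f" "\<And>x. x \<in> S \<Longrightarrow> f x \<in> {-1<..<1}"
    and "smooth_on S l" "\<And>x. x \<in> S \<Longrightarrow> l x > 0"
  shows "smooth_on S (\<lambda>x. freq (f x) (l x))"
  unfolding freq_def
  by (intro smooth_intros smooth_on_compose_ellK assms quartic_pos zero_less_power)

lemma smooth_on_compose_q_tilde:
  assumes "open S" "smooth_on S f" "\<And>x. x \<in> S \<Longrightarrow> f x \<in> {0<..<1}"
  shows "smooth_on S (\<lambda>x. q_tilde (f x))"
proof -
  have "1 - par_q k > 0" if "k \<in> {0<..<1}" for k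
    using k2_less_1[OF that] real_sqrt_gt_zero[OF quartic_pos[of k]] unfolding par_q_def by linarith
  then show ?thesis
    unfolding q_tilde_def using assms
    by (intro smooth_intros) (auto simp: par_q_def quartic_pos intro!: smooth_intros assms(1,2))
qed

lemma smooth_on_compose_a_tilde:
  assumes "open S" "smooth_on S f" "\<And>x. x \<in> S \<Longrightarrow> f x \<in> {0<..<1}"
    and "smooth_on S l" "\<And>x. x \<in> S \<Longrightarrow> l x > 0"
  shows "smooth_on S (\<lambda>x. a_tilde (f x) (l x))"
proof -
  have q: "1 - par_q k > 0" if "k \<in> {0<..<1}" for k
    using k2_less_1[OF that] real_sqrt_gt_zero[OF quartic_pos[of k]] unfolding par_q_def by linarith
  have r: "(2 - k\<^sup>2 + 2 * sqrt (k^4 - k\<^sup>2 + 1)) * y\<^sup>2 * (ellK k)\<^sup>2 > 0" if "k \<in> {0<..<1}" "y > 0" for k y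
  proof (intro mult_pos_pos zero_less_power)
    show "2 - k\<^sup>2 + 2 * sqrt (k^4 - k\<^sup>2 + 1) > 0"
      using k2_less_1[OF that(1)] real_sqrt_gt_zero[OF quartic_pos[of k]] by linarith
  qed (use that ellK_pos[of k] in auto)
  have "smooth_on S (\<lambda>x. ellK (f x))"
    using assms(3) by (intro smooth_on_compose_ellK assms) force
  then have "smooth_on S (\<lambda>x. par_a (f x) (l x))"
    unfolding par_a_def by (intro smooth_intros assms r quartic_pos) auto
  moreover have "smooth_on S (\<lambda>x. sqrt (1 - par_q (f x)))"
    unfolding par_q_def
    by (intro smooth_intros assms(1,2) quartic_pos) (rule q[unfolded par_q_def, OF assms(3)])
  moreover have "smooth_on S (\<lambda>x. sqrt (1 - (f x)\<^sup>2))"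
    using k2_less_1(2)[OF assms(3)] by (intro smooth_intros assms(1,2)) simp
  ultimately show ?thesis
    unfolding a_tilde_def using q assms(3)
    by (intro smooth_on_divide smooth_on_minus smooth_on_mult assms(1) real_sqrt_gt_zero) auto
qed

text \<open>Up to a positive factor the derivative is \<open>2 K' s\<^sup>2 + K (2 k\<^sup>3 - k)\<close> with \<open>s\<^sup>2 = k\<^sup>4 - k\<^sup>2 + 1\<close>. The estimate
  \<open>K' \<ge> k K / 2\<close> for the complete elliptic integral compensates the decrease of \<open>s\<close> for small \<open>k\<close> and leaves
  \<open>K (k\<^sup>5 + k\<^sup>3) > 0\<close>.\<close>

lemma deriv_freq_pos:
  assumes "k \<in> {0<..<1}" "L > 0"
  shows "deriv (\<lambda>k. freq k L) k > 0"
proof -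
  let ?s = "sqrt (k^4 - k\<^sup>2 + 1)"
  have k: "k \<in> {-1<..<1}" "k \<in> {0..<1}" "k > 0" using assms by auto
  have s: "?s > 0" "?s\<^sup>2 = k^4 - k\<^sup>2 + 1" using quartic_pos[of k] by auto
  have K: "(ellK has_real_derivative deriv ellK k) (at k)"
    by (rule smooth_on_has_real_derivative[OF smooth_on_compose_ellK[OF _ smooth_on_ident] k(1)]) auto
  have "((\<lambda>k. freq k L) has_real_derivative
      16 / L\<^sup>2 * (2 * ellK k * deriv ellK k * ?s + (ellK k)\<^sup>2 * ((2 * k^3 - k) / ?s))) (at k)"
    unfolding freq_def using quartic_pos[of k] s(1) assms(2)
    by (auto intro!: derivative_eq_intros K simp: field_simps)
  then have "deriv (\<lambda>k. freq k L) k =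
      16 / L\<^sup>2 * (2 * ellK k * deriv ellK k * ?s + (ellK k)\<^sup>2 * ((2 * k^3 - k) / ?s))"
    by (rule DERIV_imp_deriv)
  also have "\<dots> = 16 / L\<^sup>2 * (ellK k / ?s * (2 * deriv ellK k * ?s\<^sup>2 + ellK k * (2 * k^3 - k)))"
    using s(1) by (simp add: field_simps power2_eq_square)
  also have "\<dots> > 0"
  proof (intro mult_pos_pos divide_pos_pos)
    have "k * ellK k * ?s\<^sup>2 \<le> 2 * deriv ellK k * ?s\<^sup>2"
      using deriv_ellK_ge[OF k(2)] by (intro mult_right_mono) auto
    moreover have "k * ellK k * ?s\<^sup>2 + ellK k * (2 * k^3 - k) = ellK k * (k^5 + k^3)"
      unfolding s(2) by (simp add: algebra_simps power_numeral_reduce)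
    moreover have "ellK k * (k^5 + k^3) > 0"
      using ellK_pos[OF k(1)] k(3) by (intro mult_pos_pos add_pos_pos) auto
    ultimately show "2 * deriv ellK k * ?s\<^sup>2 + ellK k * (2 * k^3 - k) > 0" by linarith
  qed (use assms s ellK_pos[OF k(1)] in auto)
  finally show ?thesis .
qed

lemma freq_strict_mono:
  assumes "0 \<le> k" "k < k'" "k' < 1" "L > 0"
  shows "freq k L < freq k' L"
proof (rule DERIV_pos_imp_increasing_open[OF assms(2)])
  have sm: "smooth_on {-1<..<1} (\<lambda>k. freq k L)"
    using assms(4) by (intro smooth_on_compose_freq smooth_intros) auto
  show "\<exists>y. ((\<lambda>k. freq k L) has_real_derivative y) (at x) \<and> y > 0" if "k < x" "x < k'" for x
    using smooth_on_has_real_derivative[OF sm, of x] deriv_freq_pos[of x L] that assms by auto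
  show "continuous_on {k..k'} (\<lambda>k. freq k L)"
    using assms by (intro continuous_on_subset[OF smooth_on_imp_continuous_on[OF sm]]) auto
qed

text \<open>Strict monotonicity from the value \<open>4 \<pi>\<^sup>2 / L\<^sup>2\<close> at \<open>k = 0\<close>, which lies outside the range of moduli, and the
  divergence of the complete elliptic integral at \<open>k = 1\<close>.\<close>

lemma bij_betw_freq:
  assumes "L > 0"
  shows "bij_betw (\<lambda>k. freq k L) {0<..<1} {4 * pi\<^sup>2 / L\<^sup>2<..}"
  unfolding bij_betw_def
proof
  show "inj_on (\<lambda>k. freq k L) {0<..<1}"
    using freq_strict_mono[OF _ _ _ assms]
    by (intro linorder_inj_onI') (metis greaterThanLessThan_iff less_imp_le less_irrefl)
  have "\<omega> \<in> (\<lambda>k. freq k L) ` {0<..<1}" if \<omega>: "4 * pi\<^sup>2 / L\<^sup>2 < \<omega>" for \<omega>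
  proof -
    \<comment> \<open>a modulus whose frequency is at least \<open>\<omega>\<close>: by the logarithmic lower bound, \<open>sqrt (1 - k\<^sup>2) = exp (- M)\<close> forces \<open>M \<le> ellK k\<close>\<close>
    define M where "M = 1 + \<omega> * L\<^sup>2"
    have "0 \<le> 4 * pi\<^sup>2 / L\<^sup>2" by simp
    with \<omega> have "0 < \<omega>" by linarith
    then have M: "M \<ge> 1" using assms by (simp add: M_def)
    define k where "k = sqrt (1 - (exp (- M))\<^sup>2)"
    have e: "0 < exp (- M)" "exp (- M) < 1" using M by auto
    then have e2: "(exp (- M))\<^sup>2 < 1" "0 < (exp (- M))\<^sup>2" by (auto simp: abs_square_less_1)
    then have k: "0 < k" "k < 1" "k\<^sup>2 = 1 - (exp (- M))\<^sup>2" by (auto simp: k_def)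
    have kJ: "k \<in> {-1<..<1}" using k by simp
    have "sqrt (1 - k\<^sup>2) = exp (- M)" using k(3) by simp
    then have K: "M \<le> ellK k" using ellK_ge_ln[OF kJ] by simp
    have "M \<le> M\<^sup>2" using mult_left_mono[OF M, of M] M by (simp add: power2_eq_square)
    also have "\<dots> \<le> (ellK k)\<^sup>2" using K M by (intro power_mono) auto
    finally have K2: "M \<le> (ellK k)\<^sup>2" .
    have "1 / 2 \<le> sqrt (k^4 - k\<^sup>2 + 1)" 
      using sqrt_quartic_bounds(1)[of k] k2_less_1(2)[of k] k(1,2) by simp
    then have "M * (1 / 2) \<le> (ellK k)\<^sup>2 * sqrt (k^4 - k\<^sup>2 + 1)" using K2 M by (intro mult_mono) auto
    then have "\<omega> * L\<^sup>2 \<le> 16 * (ellK k)\<^sup>2 * sqrt (k^4 - k\<^sup>2 + 1)" using M by (simp add: M_def)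
    then have "\<omega> \<le> freq k L" using assms by (simp add: freq_def field_simps)
    moreover have "continuous_on {0..k} (\<lambda>k. freq k L)"
      using k assms by (intro continuous_on_subset[OF smooth_on_imp_continuous_on[OF
          smooth_on_compose_freq[of "{-1<..<1}"]]] smooth_intros) auto
    ultimately obtain x where x: "0 \<le> x" "x \<le> k" "freq x L = \<omega>"
      using IVT'[of "\<lambda>k. freq k L" 0 \<omega> k] \<omega> k by (auto simp: freq_0)
    then have "x \<noteq> 0" using \<omega> freq_0[of L] by auto
    with x k show ?thesis by (intro image_eqI[of _ _ x]) auto
  qed
  then show "(\<lambda>k. freq k L) ` {0<..<1} = {4 * pi\<^sup>2 / L\<^sup>2<..}"
    using freq_strict_mono[of 0 _ L] assms by (auto simp: freq_0)
qed

lemma modulus_of_freq: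
  assumes "L > 0" "k \<in> {0<..<1}"
  shows "modulus_of L (freq k L) = k"
  unfolding modulus_of_def
  using assms bij_betw_imp_inj_on[OF bij_betw_freq[OF assms(1)]]
  by (intro the_equality) (auto dest: inj_onD)

lemma modulus_of_in:
  assumes "L > 0" "\<omega> \<in> {4 * pi\<^sup>2 / L\<^sup>2<..}"
  shows "modulus_of L \<omega> \<in> {0<..<1}" "freq (modulus_of L \<omega>) L = \<omega>"
proof -
  obtain k where "k \<in> {0<..<1}" "freq k L = \<omega>"
    using assms(2) unfolding bij_betw_imp_surj_on[OF bij_betw_freq[OF assms(1)], symmetric] by blast
  with modulus_of_freq[OF assms(1)] show "modulus_of L \<omega> \<in> {0<..<1}" "freq (modulus_of L \<omega>) L = \<omega>" by auto
qed

lemma smooth_on_modulus_of: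
  assumes "L > 0"
  shows "smooth_on {4 * pi\<^sup>2 / L\<^sup>2<..} (modulus_of L)"
proof -
  let ?f = "\<lambda>k. freq k L"
  have sm: "smooth_on {0<..<1} ?f" using assms by (intro smooth_on_compose_freq smooth_intros) auto
  have "smooth_on (?f ` {0<..<1}) (modulus_of L)"
  proof (rule smooth_on_left_inverse(2))
    show "(?f has_derivative (*) (deriv ?f k)) (at k)" if "k \<in> {0<..<1}" for k
      using smooth_on_has_real_derivative[OF sm that] by (simp add: has_field_derivative_def)
    show "deriv ?f k * (v / deriv ?f k) = v" if "k \<in> {0<..<1}" for k v
      using deriv_freq_pos[OF that assms] by simp
    show "smooth_on {0<..<1} (\<lambda>k. v / deriv ?f k)" for v
      using deriv_freq_pos[OF _ assms] by (intro smooth_on_divide smooth_on_deriv sm smooth_on_const) auto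
  qed (use modulus_of_freq[OF assms] in auto)
  then show ?thesis by (simp add: bij_betw_imp_surj_on[OF bij_betw_freq[OF assms]])
qed

lemma q_tilde_alt: "q_tilde k = (1 + sqrt (k^4 - k\<^sup>2 + 1)) / (2 - k\<^sup>2 + sqrt (k^4 - k\<^sup>2 + 1))"
  by (simp add: q_tilde_def par_q_def algebra_simps)

lemma q_tilde_bounds:
  assumes "k \<in> {0<..<1}"
  shows "q_tilde k \<in> {2 / 3<..<1}"
  using k2_less_1[OF assms] sqrt_quartic_bounds[OF assms] unfolding q_tilde_alt by (simp add: field_simps)

lemma a_tilde_power4:
  assumes "k \<in> {0<..<1}" "L > 0"
  shows "a_tilde k L ^ 4 = (4 * ellK k / L)\<^sup>2 * ((2 - k\<^sup>2 + 2 * sqrt (k^4 - k\<^sup>2 + 1)) * (1 - k\<^sup>2)\<^sup>2 /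
      (2 - k\<^sup>2 + sqrt (k^4 - k\<^sup>2 + 1))\<^sup>2)"
proof -
  let ?s = "sqrt (k^4 - k\<^sup>2 + 1)"
  note b = k2_less_1[OF assms(1)] sqrt_quartic_bounds[OF assms(1)]
  have p: "(2 - k\<^sup>2 + 2 * ?s) * L\<^sup>2 * (ellK k)\<^sup>2 \<ge> 0" using b by (intro mult_nonneg_nonneg) auto
  have sq4: "sqrt x ^ 4 = x\<^sup>2" if "x \<ge> 0" for x
    using that by (metis power4_eq_xxxx power2_eq_square real_sqrt_mult_self abs_of_nonneg mult.assoc)
  have e: "1 - par_q k = 2 - k\<^sup>2 + ?s" by (simp add: par_q_def)
  have "a_tilde k L ^ 4 = (2 / L) ^ 4 * ((2 - k\<^sup>2 + 2 * ?s) * L\<^sup>2 * (ellK k)\<^sup>2) * (1 - k\<^sup>2)\<^sup>2 / (2 - k\<^sup>2 + ?s)\<^sup>2"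
    unfolding a_tilde_def par_a_def e
    using b by (simp add: power_divide power_mult_distrib sq4 real_root_pow_pos2[OF _ p])
  also have "\<dots> = (4 * ellK k / L)\<^sup>2 * ((2 - k\<^sup>2 + 2 * ?s) * (1 - k\<^sup>2)\<^sup>2 / (2 - k\<^sup>2 + ?s)\<^sup>2)"
  proof -
    have "(2 / L) ^ 4 * (x * L\<^sup>2 * (ellK k)\<^sup>2) * y / z = (4 * ellK k / L)\<^sup>2 * (x * y / z)" for x y z
      using assms(2) by (simp add: power_divide power_mult_distrib power2_eq_square power4_eq_xxxx)
    then show ?thesis .
  qed
  finally show ?thesis .
qed

lemma a_tilde_neg:
  assumes "k \<in> {0<..<1}" "L > 0"
  shows "a_tilde k L < 0"
proof -
  let ?s = "sqrt (k^4 - k\<^sup>2 + 1)"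
  note b = k2_less_1[OF assms(1)] sqrt_quartic_bounds[OF assms(1)]
  have "ellK k > 0" using assms by (intro ellK_pos) auto
  then have "(2 - k\<^sup>2 + 2 * ?s) * L\<^sup>2 * (ellK k)\<^sup>2 > 0" 
    using b assms by (intro mult_pos_pos zero_less_power) auto
  then have "par_a k L > 0" using assms by (simp add: par_a_def)
  moreover have "1 - par_q k > 0" using b by (simp add: par_q_def)
  ultimately show ?thesis using b by (simp add: a_tilde_def)
qed

text \<open>The bound is the limit at \<open>k = 0\<close>. The crude estimate \<open>K \<le> \<pi> / (2 sqrt (1 - k\<^sup>2))\<close> costs one of the two factors
  \<open>1 - k\<^sup>2\<close> in the fourth power of the amplitude, and the remaining one still suffices.\<close>

lemma a_tilde_gt:
  assumes "k \<in> {0<..<1}" "L > 0"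
  shows "- (2 * sqrt 3 / 3 * sqrt (pi / L)) < a_tilde k L"
proof -
  define m s where "m = k\<^sup>2" and "s = sqrt (k^4 - k\<^sup>2 + 1)"
  have b: "0 < m" "m < 1" "1 - m / 2 < s" "s < 1"
    using k2_less_1[OF assms(1)] sqrt_quartic_bounds[OF assms(1)] by (auto simp: m_def s_def)
  have kJ: "k \<in> {-1<..<1}" using assms by auto
  have K: "(ellK k)\<^sup>2 \<le> (pi / 2)\<^sup>2 / (1 - m)"
    using power_mono[OF ellK_le[OF kJ], of 2] ellK_pos[OF kJ] b by (simp add: power_divide m_def power_mult_distrib)
  have "9 * ((2 - m + 2 * s) * (1 - m)) < 9 * (4 * (1 - m))"
    using b by (intro mult_strict_left_mono mult_strict_right_mono) auto
  also have "\<dots> \<le> 4 * (3 / 2 * (2 - m))\<^sup>2" using b by (simp add: power2_eq_square algebra_simps)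
  also have "\<dots> \<le> 4 * (2 - m + s)\<^sup>2" using b by (intro mult_left_mono power_mono) auto
  finally have *: "(2 - m + 2 * s) * (1 - m) / (2 - m + s)\<^sup>2 < 4 / 9"
    using b by (simp add: field_simps)
  have "a_tilde k L ^ 4 = 16 / L\<^sup>2 * ((ellK k)\<^sup>2 * ((2 - m + 2 * s) * (1 - m)\<^sup>2 / (2 - m + s)\<^sup>2))"
    unfolding a_tilde_power4[OF assms] m_def s_def by (simp add: power_divide power_mult_distrib)
  also have "\<dots> \<le> 16 / L\<^sup>2 * ((pi / 2)\<^sup>2 / (1 - m) * ((2 - m + 2 * s) * (1 - m)\<^sup>2 / (2 - m + s)\<^sup>2))"
    using b K by (intro mult_left_mono mult_right_mono) auto
  also have "\<dots> = 16 / L\<^sup>2 * ((pi / 2)\<^sup>2 * ((2 - m + 2 * s) * (1 - m) / (2 - m + s)\<^sup>2))"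
  proof -
    have "x / c * (y * c\<^sup>2 / z) = x * (y * c / z)" if "c \<noteq> 0" for x y z c :: real
      using that by (simp add: power2_eq_square)
    from this[of "1 - m"] show ?thesis using b by simp
  qed
  also have "\<dots> < 16 / L\<^sup>2 * ((pi / 2)\<^sup>2 * (4 / 9))"
    using b * assms by (intro mult_strict_left_mono) auto
  also have "\<dots> = (2 * sqrt 3 / 3 * sqrt (pi / L)) ^ 4"
  proof -
    have "(2 * sqrt 3 / 3 * sqrt (pi / L)) ^ (2 * 2) = ((2 * sqrt 3 / 3 * sqrt (pi / L))\<^sup>2)\<^sup>2"
      by (rule power_mult)
    also have "(2 * sqrt 3 / 3 * sqrt (pi / L))\<^sup>2 = 4 / 3 * (pi / L)"
      using assms(2) by (simp add: power_mult_distrib power_divide)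
    also have "(4 / 3 * (pi / L))\<^sup>2 = 16 / L\<^sup>2 * ((pi / 2)\<^sup>2 * (4 / 9))"
      by (simp add: power_mult_distrib power_divide)
    finally show ?thesis by simp
  qed
  finally have "\<bar>a_tilde k L\<bar> ^ 4 < (2 * sqrt 3 / 3 * sqrt (pi / L)) ^ 4"
    by (simp only: power_even_abs_numeral even_numeral)
  moreover have "0 \<le> 2 * sqrt 3 / 3 * sqrt (pi / L)" using assms(2) by simp
  ultimately have "\<bar>a_tilde k L\<bar> < 2 * sqrt 3 / 3 * sqrt (pi / L)"
    by (rule power_less_imp_less_base)
  then show ?thesis by linarith
qed

section \<open>The profile and its equation\<close>

text \<open>Here \<open>\<phi>\<close> is a rescaled amplitude and \<open>m = k\<^sup>2\<close>. Differentiating twice, the second derivative of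
  \<open>f = A S / D\<close> is \<open>A \<beta>\<^sup>2 S / D\<^sup>5\<close> times a quadratic polynomial in \<open>S\<^sup>2\<close>. As \<open>f = A S D\<^sup>4 / D\<^sup>5\<close> and
  \<open>f\<^sup>5 = A\<^sup>5 S\<^sup>5 / D\<^sup>5\<close>, the equation says that two such polynomials agree, and the hypotheses \<open>c0\<close>, \<open>c1\<close> and
  \<open>c2\<close> are the comparison of their three coefficients.\<close>

lemma quintic_ode_of_amplitude:
  fixes \<phi> :: "real \<Rightarrow> real" and A \<beta> m q s :: real
  assumes \<phi>: "\<And>x. (\<phi> has_real_derivative \<beta> * sqrt (1 - m * (sin (\<phi> x))\<^sup>2)) (at x)"
    and m: "0 \<le> m" "m < 1" and q: "0 \<le> q" "q < 1"
    and c0: "3 * q - 1 - m = s" and c1: "q * (1 + m) - m = s * q"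
    and c2: "A ^ 4 = \<beta>\<^sup>2 * (s * q\<^sup>2 - m * q)"
  defines "f \<equiv> \<lambda>x. A * sin (\<phi> x) / sqrt (1 - q * (sin (\<phi> x))\<^sup>2)"
  shows "\<exists>f' f''. \<forall>x. (f has_real_derivative f' x) (at x) \<and> (f' has_real_derivative f'' x) (at x) \<and>
    - f'' x + \<beta>\<^sup>2 * s * f x - f x ^ 5 = 0"
proof -
  define S C \<Delta> D where "S x = sin (\<phi> x)" and "C x = cos (\<phi> x)" and "\<Delta> x = sqrt (1 - m * (S x)\<^sup>2)"
    and "D x = sqrt (1 - q * (S x)\<^sup>2)" for x
  have C2: "(C x)\<^sup>2 = 1 - (S x)\<^sup>2" for x by (simp add: C_def S_def cos_squared_eq)
  have \<Delta>: "\<Delta> x > 0" "(\<Delta> x)\<^sup>2 = 1 - m * (S x)\<^sup>2" for x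
    using one_minus_mult_sin2_pos[OF m, of "\<phi> x"] by (auto simp: \<Delta>_def S_def)
  have D: "D x > 0" "(D x)\<^sup>2 = 1 - q * (S x)\<^sup>2" for x
    using one_minus_mult_sin2_pos[OF q, of "\<phi> x"] by (auto simp: D_def S_def)
  have dS: "(S has_real_derivative C x * (\<beta> * \<Delta> x)) (at x)" for x
    unfolding S_def[abs_def] C_def \<Delta>_def by (rule DERIV_chain2[OF DERIV_sin \<phi>])
  have dC: "(C has_real_derivative - S x * (\<beta> * \<Delta> x)) (at x)" for x
    unfolding C_def[abs_def] S_def \<Delta>_def by (rule DERIV_chain2[OF DERIV_cos \<phi>])
  have dR: "((\<lambda>x. sqrt (1 - r * (S x)\<^sup>2)) has_real_derivative - r * S x * C x * \<beta> * \<Delta> x / sqrt (1 - r * (S x)\<^sup>2)) (at x)"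
    if "1 - r * (S x)\<^sup>2 > 0" for r x
    using that by (auto intro!: derivative_eq_intros dS simp: field_simps)
  have d\<Delta>: "(\<Delta> has_real_derivative - m * S x * C x * \<beta>) (at x)" for x
    using dR[of m x] \<Delta>[of x] by (simp add: \<Delta>_def[abs_def])
  have dD: "(D has_real_derivative - q * S x * C x * \<beta> * \<Delta> x / D x) (at x)" for x
    using dR[of q x] D[of x] by (simp add: D_def[abs_def])
  have f: "f = (\<lambda>x. A * S x / D x)" by (simp add: f_def S_def D_def)
  define f' where "f' x = A * \<beta> * C x * \<Delta> x / D x ^ 3" for x
  define f'' where "f'' x = A * \<beta>\<^sup>2 * S x * (3 * q * (C x)\<^sup>2 * (\<Delta> x)\<^sup>2 - ((\<Delta> x)\<^sup>2 + m * (C x)\<^sup>2) * (D x)\<^sup>2) / D x ^ 5" for x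
  have f': "(f has_real_derivative f' x) (at x)" for x
  proof -
    have "A * C x * (\<beta> * \<Delta> x) * D x - A * S x * (- q * S x * C x * \<beta> * \<Delta> x / D x)
        = A * \<beta> * C x * \<Delta> x * ((D x)\<^sup>2 + q * (S x)\<^sup>2) / D x"
      using D(1)[of x] by (simp add: field_simps power2_eq_square)
    then have "(A * C x * (\<beta> * \<Delta> x) * D x - A * S x * (- q * S x * C x * \<beta> * \<Delta> x / D x)) / (D x * D x) = f' x"
      using D(1)[of x] by (simp add: D(2) f'_def power3_eq_cube)
    moreover have "(f has_real_derivative
        (A * C x * (\<beta> * \<Delta> x) * D x - A * S x * (- q * S x * C x * \<beta> * \<Delta> x / D x)) / (D x * D x)) (at x)"
      unfolding f using D(1)[of x] DERIV_cmult[OF dS, of A x] by (intro DERIV_divide dD) (auto simp: mult.assoc)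
    ultimately show ?thesis by simp
  qed
  have f'': "(f' has_real_derivative f'' x) (at x)" for x
  proof -
    have "(f' has_real_derivative
        ((A * \<beta> * (- S x * (\<beta> * \<Delta> x)) * \<Delta> x + (- m * S x * C x * \<beta>) * (A * \<beta> * C x)) * D x ^ 3
          - A * \<beta> * C x * \<Delta> x * (3 * (- q * S x * C x * \<beta> * \<Delta> x / D x) * (D x)\<^sup>2)) / (D x ^ 3 * D x ^ 3)) (at x)"
      unfolding f'_def[abs_def] using D(1)[of x]
      by (auto intro!: derivative_eq_intros dC d\<Delta> dD simp: power2_eq_square)
    also have "((A * \<beta> * (- S x * (\<beta> * \<Delta> x)) * \<Delta> x + (- m * S x * C x * \<beta>) * (A * \<beta> * C x)) * D x ^ 3
          - A * \<beta> * C x * \<Delta> x * (3 * (- q * S x * C x * \<beta> * \<Delta> x / D x) * (D x)\<^sup>2)) / (D x ^ 3 * D x ^ 3) = f'' x"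
      using D(1)[of x] unfolding f''_def
      by (simp add: field_simps power2_eq_square power3_eq_cube power_numeral_reduce)
    finally show ?thesis .
  qed
  have "- f'' x + \<beta>\<^sup>2 * s * f x - f x ^ 5 = 0" for x
  proof -
    define t where "t = (S x)\<^sup>2"
    have D4: "D x ^ 4 = (1 - q * t)\<^sup>2"
      using arg_cong[OF D(2)[of x], of "\<lambda>u. u\<^sup>2"] by (simp add: t_def)
    have poly: "3 * q * (1 - t) * (1 - m * t) - ((1 - m * t) + m * (1 - t)) * (1 - q * t)
        = s * (1 - q * t)\<^sup>2 - (s * q\<^sup>2 - m * q) * t\<^sup>2"
    proof -
      have "3 * q * (1 - t) * (1 - m * t) - ((1 - m * t) + m * (1 - t)) * (1 - q * t)
          = (3 * q - 1 - m) - 2 * (q * (1 + m) - m) * t + m * q * t\<^sup>2"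
        by (simp add: algebra_simps power2_eq_square)
      also have "\<dots> = s * (1 - q * t)\<^sup>2 - (s * q\<^sup>2 - m * q) * t\<^sup>2"
        unfolding c0 c1 by (simp add: algebra_simps power2_eq_square)
      finally show ?thesis .
    qed
    have "f'' x = A * \<beta>\<^sup>2 * S x * (s * D x ^ 4 - (s * q\<^sup>2 - m * q) * t\<^sup>2) / D x ^ 5"
      unfolding f''_def C2 \<Delta>(2) D(2) t_def[symmetric] poly D4 ..
    also have "\<dots> = \<beta>\<^sup>2 * s * (A * S x / D x) - A * S x * (\<beta>\<^sup>2 * (s * q\<^sup>2 - m * q)) * t\<^sup>2 / D x ^ 5"
      using D(1)[of x] by (simp add: field_simps power_numeral_reduce)
    also have "A * S x * (\<beta>\<^sup>2 * (s * q\<^sup>2 - m * q)) * t\<^sup>2 / D x ^ 5 = (A * S x / D x) ^ 5"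
      unfolding c2[symmetric] t_def by (simp add: power_divide power_mult_distrib power_numeral_reduce)
    finally show ?thesis by (simp add: f)
  qed
  with f' f'' show ?thesis by blast
qed

text \<open>The coefficient conditions for the quintic equation, consequences of \<open>s\<^sup>2 = m\<^sup>2 - m + 1\<close>; the last right-hand side is
  \<open>a_tilde\<^sup>4 / \<beta>\<^sup>2\<close> with \<open>\<beta> = 4 K / L\<close>.\<close>

lemma q_tilde_identities:
  assumes "k \<in> {0<..<1}"
  defines "m \<equiv> k\<^sup>2" and "s \<equiv> sqrt (k^4 - k\<^sup>2 + 1)"
  shows "3 * q_tilde k - 1 - m = s"
    and "q_tilde k * (1 + m) - m = s * q_tilde k"
    and "s * (q_tilde k)\<^sup>2 - m * q_tilde k = (2 - m + 2 * s) * (1 - m)\<^sup>2 / (2 - m + s)\<^sup>2"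
proof -
  have s2: "s * s = m * m - m + 1"
    using quartic_pos[of k] by (simp add: s_def m_def power4_eq_xxxx power2_eq_square)
  have d: "2 - m + s > 0"
    using k2_less_1[OF assms(1)] sqrt_quartic_bounds[OF assms(1)] by (simp add: m_def s_def)
  have q: "q_tilde k = (1 + s) / (2 - m + s)" by (simp add: q_tilde_alt m_def s_def)
  show e1: "3 * q_tilde k - 1 - m = s"
    using d s2 unfolding q by (simp add: field_simps)
  have q': "q_tilde k = (1 + m + s) / 3" using e1 by simp
  show e2: "q_tilde k * (1 + m) - m = s * q_tilde k"
    using s2 unfolding q' by (simp add: field_simps)
  have "(s * (q_tilde k)\<^sup>2 - m * q_tilde k) * (2 - m + s)\<^sup>2 = (1 + s) * (s * (1 + s) - m * (2 - m + s))"
  proof -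
    have "(2 - m + s) * q_tilde k = 1 + s" using d by (simp add: q)
    then show ?thesis by (simp add: power2_eq_square algebra_simps) algebra
  qed
  also have "\<dots> = (2 - m + 2 * s) * (1 - m)\<^sup>2" using s2 by algebra
  finally show "s * (q_tilde k)\<^sup>2 - m * q_tilde k = (2 - m + 2 * s) * (1 - m)\<^sup>2 / (2 - m + s)\<^sup>2"
    using d by (simp add: field_simps)
qed

text \<open>The factor \<open>r\<close> with \<open>c r\<^sup>4 = 1\<close> absorbs the coefficient \<open>c\<close> of the quintic term.\<close>

lemma solves_eq_snoidal:
  assumes c: "\<kappa> + \<gamma> * B^3 > 0" and k: "k \<in> {0<..<1}" and L: "L > 0"
  shows "solves_eq \<kappa> \<gamma> B (freq k L) (snoidal \<kappa> \<gamma> B L k)"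
proof -
  define c where "c = \<kappa> + \<gamma> * B^3"
  define \<beta> where "\<beta> = 4 * ellK k / L"
  let ?\<phi> = "\<lambda>x. jacobi_am (\<beta> * x) k" and ?q = "q_tilde k"
  have kJ: "k \<in> {-1<..<1}" using k by simp
  have d\<phi>: "(?\<phi> has_real_derivative \<beta> * sqrt (1 - k\<^sup>2 * (sin (?\<phi> x))\<^sup>2)) (at x)" for x
    using DERIV_chain2[OF has_real_derivative_jacobi_am[OF kJ] DERIV_cmult_Id[of \<beta> x]] by (simp add: mult.commute)
  obtain f' f'' where f: "\<And>x. ((\<lambda>x. a_tilde k L * sin (?\<phi> x) / sqrt (1 - ?q * (sin (?\<phi> x))\<^sup>2)) has_real_derivative f' x) (at x)"
      "\<And>x. (f' has_real_derivative f'' x) (at x)"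
      "\<And>x. - f'' x + \<beta>\<^sup>2 * sqrt (k^4 - k\<^sup>2 + 1) * (a_tilde k L * sin (?\<phi> x) / sqrt (1 - ?q * (sin (?\<phi> x))\<^sup>2))
        - (a_tilde k L * sin (?\<phi> x) / sqrt (1 - ?q * (sin (?\<phi> x))\<^sup>2)) ^ 5 = 0"
    using quintic_ode_of_amplitude[OF d\<phi> _ _ _ _ q_tilde_identities(1,2)[OF k], of "a_tilde k L"]
      k2_less_1[OF k] q_tilde_bounds[OF k] a_tilde_power4[OF k L] q_tilde_identities(3)[OF k]
    unfolding \<beta>_def by auto
  define u where "u x = a_tilde k L * sin (?\<phi> x) / sqrt (1 - ?q * (sin (?\<phi> x))\<^sup>2)" for x
  define r where "r = 1 / root 4 c"
  have r: "c * r ^ 4 = 1" using c by (simp add: r_def c_def power_divide)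
  have eq: "snoidal \<kappa> \<gamma> B L k = (\<lambda>x. r * u x)"
    by (simp add: fun_eq_iff snoidal_def jacobi_sn_def u_def r_def c_def \<beta>_def)
  have freq: "freq k L = \<beta>\<^sup>2 * sqrt (k^4 - k\<^sup>2 + 1)"
    by (simp add: freq_def \<beta>_def power_divide power_mult_distrib)
  show ?thesis
    unfolding solves_eq_def eq freq c_def[symmetric]
  proof (intro exI allI conjI)
    fix x
    show "((\<lambda>x. r * u x) has_real_derivative r * f' x) (at x)"
      unfolding u_def by (rule DERIV_cmult[OF f(1)])
    show "((\<lambda>x. r * f' x) has_real_derivative r * f'' x) (at x)"
      by (rule DERIV_cmult[OF f(2)])
    have "- (r * f'' x) + \<beta>\<^sup>2 * sqrt (k^4 - k\<^sup>2 + 1) * (r * u x) - c * (r * u x) ^ 5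
        = r * (- f'' x + \<beta>\<^sup>2 * sqrt (k^4 - k\<^sup>2 + 1) * u x - (c * r ^ 4) * u x ^ 5)"
      by (simp add: algebra_simps power_mult_distrib power_numeral_reduce)
    also have "\<dots> = 0" using f(3)[of x] unfolding r u_def by simp
    finally show "- (r * f'' x) + \<beta>\<^sup>2 * sqrt (k^4 - k\<^sup>2 + 1) * (r * u x) - c * (r * u x) ^ 5 = 0" .
  qed
qed

lemma periodic_with_snoidal:
  assumes "k \<in> {0<..<1}" "L > 0"
  shows "periodic_with L (snoidal \<kappa> \<gamma> B L k)"
proof -
  have "4 * ellK k / L * (x + L) = 4 * ellK k / L * x + 4 * ellK k" for x
    using assms(2) by (simp add: field_simps)
  then show ?thesis
    using assms(1) jacobi_am_add_4K[of k] by (simp add: periodic_with_def snoidal_def jacobi_sn_def)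
qed

text \<open>The profile is a composition of smooth maps; its denominator stays positive because \<open>q_tilde k < 1\<close>.\<close>

lemma smooth_on_psi:
  assumes c: "\<kappa> + \<gamma> * B^3 > 0" and L: "L > 0"
  shows "smooth_on ({4 * pi\<^sup>2 / L\<^sup>2<..} \<times> UNIV) (\<lambda>(\<omega>, x). psi \<kappa> \<gamma> B L \<omega> x)"
proof -
  let ?I = "{4 * pi\<^sup>2 / L\<^sup>2<..}"
  let ?S = "?I \<times> UNIV :: (real \<times> real) set"
  have opn: "open ?S" by (auto intro!: open_Times)
  define k where "k z = modulus_of L (fst z)" for z :: "real \<times> real"
  have k: "k z \<in> {0<..<1}" if "z \<in> ?S" for z
    using modulus_of_in(1)[OF L] that by (auto simp: k_def)
  have k': "k z \<in> {-1<..<1}" if "z \<in> ?S" for z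
    using k[OF that] by simp
  have sk: "smooth_on ?S k"
    unfolding k_def by (rule smooth_on_compose[OF opn smooth_on_modulus_of[OF L]]) (auto intro!: smooth_intros opn)
  define u where "u z = jacobi_am (4 * ellK (k z) / L * snd z) (k z)" for z
  have su: "smooth_on ?S u"
    unfolding u_def using L
    by (intro smooth_on_compose_jacobi_am smooth_intros smooth_on_compose_ellK opn sk k')
  have "smooth_on ?S (\<lambda>z. 1 / root 4 (\<kappa> + \<gamma> * B^3) * (a_tilde (k z) L * sin (u z) / sqrt (1 - q_tilde (k z) * (sin (u z))\<^sup>2)))"
  proof (intro smooth_intros smooth_on_compose_a_tilde smooth_on_compose_q_tilde opn sk k su L)
    show "0 < sqrt (1 - q_tilde (k z) * (sin (u z))\<^sup>2)" "0 < 1 - q_tilde (k z) * (sin (u z))\<^sup>2" if "z \<in> ?S" for z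
      using q_tilde_bounds[OF k[OF that]] one_minus_mult_sin2_pos[of "q_tilde (k z)" "u z"] by auto
  qed (use c in auto)
  then show ?thesis
    by (simp add: case_prod_unfold psi_def snoidal_def jacobi_sn_def k_def u_def)
qed

lemma coefficient_pos:
  fixes \<kappa> \<gamma> B :: real
  assumes "\<kappa> > 0" "\<gamma> \<ge> 0"
    and "(\<gamma> > 2 * \<kappa> \<and> (B = (\<gamma> + sqrt (\<gamma>\<^sup>2 - 4 * \<kappa>\<^sup>2)) / (2 * \<kappa>) \<or>
                       B = (\<gamma> - sqrt (\<gamma>\<^sup>2 - 4 * \<kappa>\<^sup>2)) / (2 * \<kappa>)))
         \<or> B = 1 \<or> (\<gamma> < \<kappa> \<and> B = - 1)"
  shows "\<kappa> + \<gamma> * B^3 > 0"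
proof -
  have "B \<ge> 0" if "\<gamma> > 2 * \<kappa>" "B = (\<gamma> + sqrt (\<gamma>\<^sup>2 - 4 * \<kappa>\<^sup>2)) / (2 * \<kappa>) \<or> B = (\<gamma> - sqrt (\<gamma>\<^sup>2 - 4 * \<kappa>\<^sup>2)) / (2 * \<kappa>)"
  proof -
    have "sqrt (\<gamma>\<^sup>2 - 4 * \<kappa>\<^sup>2) \<le> \<gamma>" using assms(2) by (intro real_le_lsqrt) auto
    moreover have "(2 * \<kappa>)\<^sup>2 \<le> \<gamma>\<^sup>2" using that(1) assms(1) by (intro power_mono) auto
    then have "0 \<le> sqrt (\<gamma>\<^sup>2 - 4 * \<kappa>\<^sup>2)" by (simp add: power_mult_distrib)
    ultimately have "0 \<le> (\<gamma> + sqrt (\<gamma>\<^sup>2 - 4 * \<kappa>\<^sup>2)) / (2 * \<kappa>)" "0 \<le> (\<gamma> - sqrt (\<gamma>\<^sup>2 - 4 * \<kappa>\<^sup>2)) / (2 * \<kappa>)"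
      using assms(1,2) by (auto intro!: divide_nonneg_nonneg)
    with that(2) show ?thesis by metis
  qed
  then consider "B \<ge> 0" | "\<gamma> < \<kappa>" "B = - 1" using assms(3) by fastforce
  then show ?thesis using assms(1,2) by cases (auto intro!: add_pos_nonneg)
qed

section \<open>Smooth curves in the periodic Sobolev space\<close>

lemma fourier_coeff_continuous:
  assumes "continuous_on UNIV f"
  shows "fourier_coeff L f n =
    integral {0..L} (\<lambda>x. complex_of_real (f x) * exp (- (2 * of_real pi * \<i> * of_int n * of_real x / of_real L))) / of_real L"
proof -
  have "continuous_on {0..L} (\<lambda>x. complex_of_real (f x) * exp (- (2 * of_real pi * \<i> * of_int n * of_real x / of_real L)))"
    by (cases "L = 0") (auto intro!: continuous_intros continuous_on_subset[OF assms])
  then have "(\<lambda>x. complex_of_real (f x) * exp (- (2 * of_real pi * \<i> * of_int n * of_real x / of_real L)))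
      absolutely_integrable_on {0..L}"
    by (rule absolutely_integrable_continuous_real)
  then show ?thesis
    unfolding fourier_coeff_def by (simp add: set_lebesgue_integral_eq_integral(2))
qed

lemma norm_fourier_coeff_le:
  assumes "L > 0" "continuous_on UNIV f" "\<And>x. x \<in> {0..L} \<Longrightarrow> \<bar>f x\<bar> \<le> M"
  shows "cmod (fourier_coeff L f n) \<le> M"
proof -
  let ?g = "\<lambda>x. complex_of_real (f x) * exp (- (2 * of_real pi * \<i> * of_int n * of_real x / of_real L))"
  have "?g integrable_on {0..L}"
    using assms(1) by (intro integrable_continuous_real) (auto intro!: continuous_intros continuous_on_subset[OF assms(2)])
  moreover have "cmod (?g x) \<le> M" if "x \<in> {0..L}" for x
  proof -
    have "Re (2 * of_real pi * \<i> * of_int n * of_real x / of_real L) = 0"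
      by (simp add: Re_divide_of_real)
    then show ?thesis using assms(3)[OF that] by (simp add: norm_mult norm_exp_eq_Re)
  qed
  moreover have "0 \<le> M" using assms(1) assms(3)[of 0] by force
  ultimately have "cmod (integral {0..L} ?g) \<le> M * measure lborel {0..L}"
    by (intro has_integral_bound_real[OF _ finite.emptyI integrable_integral]) auto
  then show ?thesis
    using assms(1) by (simp add: fourier_coeff_continuous[OF assms(2)] norm_divide field_simps)
qed

text \<open>Integration by parts; the boundary terms cancel by periodicity.\<close>

lemma fourier_coeff_deriv:
  assumes L: "L > 0" and per: "periodic_with L f"
    and f': "\<And>x. (f has_real_derivative f' x) (at x)" and cont: "continuous_on UNIV f'"
  shows "fourier_coeff L f' n = 2 * of_real pi * \<i> * of_int n / of_real L * fourier_coeff L f n"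
proof -
  define c where "c = 2 * of_real pi * \<i> * of_int n / complex_of_real L"
  define e where "e x = exp (- (c * of_real x))" for x :: real
  have e: "exp (- (2 * of_real pi * \<i> * of_int n * of_real x / of_real L)) = e x" for x :: real
    by (simp add: e_def c_def)
  have contf: "continuous_on UNIV f"
    using f' by (meson DERIV_isCont continuous_at_imp_continuous_on)
  have eL: "e L = 1"
  proof -
    have "e L = exp (2 * of_int (- n) * of_real pi * \<i>)" using L by (simp add: e_def c_def field_simps)
    then show ?thesis using exp_integer_2pi[of "of_int (- n)"] by simp
  qed
  have "((\<lambda>x. of_real (f' x) * e x - c * (of_real (f x) * e x)) has_integral
      of_real (f L) * e L - of_real (f 0) * e 0) {0..L}"
  proof (rule fundamental_theorem_of_calculus)
    fix x
    have "((\<lambda>x. of_real (f x)) has_vector_derivative complex_of_real (f' x)) (at x within {0..L})"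
      using f'[of x] by (intro has_vector_derivative_of_real has_vector_derivative_at_within)
        (simp add: has_real_derivative_iff_has_vector_derivative)
    moreover have "(e has_vector_derivative - c * e x) (at x within {0..L})"
    proof -
      have "((\<lambda>z. exp (- (c * z))) has_field_derivative - c * exp (- (c * of_real x))) (at (of_real x))"
        by (auto intro!: derivative_eq_intros)
      from has_vector_derivative_real_field[OF this] show ?thesis
        by (simp add: e_def[abs_def] has_vector_derivative_at_within)
    qed
    ultimately have "((\<lambda>x. of_real (f x) * e x) has_vector_derivative of_real (f x) * (- c * e x) + of_real (f' x) * e x)
        (at x within {0..L})"
      by (rule has_vector_derivative_mult)
    then show "((\<lambda>x. of_real (f x) * e x) has_vector_derivative of_real (f' x) * e x - c * (of_real (f x) * e x))
        (at x within {0..L})"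
      by (simp add: algebra_simps)
  qed (use L in simp)
  moreover have "f L = f 0" using per[unfolded periodic_with_def, rule_format, of 0] by simp
  ultimately have 0: "((\<lambda>x. of_real (f' x) * e x - c * (of_real (f x) * e x)) has_integral 0) {0..L}"
    using eL by (simp add: e_def)
  have "(\<lambda>x. of_real (f' x) * e x) integrable_on {0..L}" "(\<lambda>x. of_real (f x) * e x) integrable_on {0..L}"
    unfolding e_def
    by (intro integrable_continuous_real continuous_intros continuous_on_subset[OF cont] continuous_on_subset[OF contf]; simp)+
  then have "integral {0..L} (\<lambda>x. of_real (f' x) * e x) = c * integral {0..L} (\<lambda>x. of_real (f x) * e x)"
    using integral_unique[OF 0] by (simp add: integral_diff integrable_on_mult_right)
  then show ?thesis
    by (simp add: fourier_coeff_continuous[OF cont] fourier_coeff_continuous[OF contf] e flip: c_def)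
qed

lemma periodic_with_deriv:
  assumes "periodic_with L f" "\<And>x. (f has_real_derivative f' x) (at x)"
  shows "periodic_with L f'"
  unfolding periodic_with_def
proof
  fix x
  have "((\<lambda>x. f (x + L)) has_real_derivative f' (x + L)) (at x)"
    using assms(2)[of "x + L"] by (simp add: DERIV_shift)
  moreover have "(\<lambda>x. f (x + L)) = f" using assms(1) by (auto simp: periodic_with_def)
  ultimately show "f' (x + L) = f' x" using assms(2)[of x] DERIV_unique by metis
qed

lemma summable_on_inverse_one_plus_square: "(\<lambda>n::int. 1 / (1 + (of_int n)\<^sup>2) :: real) summable_on UNIV"
proof -
  let ?w = "\<lambda>n::int. 1 / (1 + (of_int n)\<^sup>2) :: real"
  have "summable (\<lambda>n. inverse ((real (Suc n))\<^sup>2))"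
    by (subst summable_Suc_iff) (rule inverse_power_summable, simp)
  then have "summable (\<lambda>n. 1 / (1 + (real n)\<^sup>2))"
  proof (rule summable_comparison_test'[where N = 0, OF summable_mult[of _ 2]])
    fix n :: nat
    have "(real (Suc n))\<^sup>2 \<le> 2 * (1 + (real n)\<^sup>2)"
      using zero_le_power2[of "real n - 1"] by (simp add: power2_eq_square algebra_simps)
    then show "norm (1 / (1 + (real n)\<^sup>2)) \<le> 2 * inverse ((real (Suc n))\<^sup>2)"
      by (simp add: field_simps add_pos_nonneg)
  qed
  then have nat: "(\<lambda>n::nat. 1 / (1 + (real n)\<^sup>2)) summable_on UNIV"
    by (intro norm_summable_imp_summable_on) simp
  have 1: "?w summable_on range int"
    by (subst summable_on_reindex) (use nat in \<open>auto simp: o_def\<close>)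
  have 2: "?w summable_on range (\<lambda>n. - int n)"
    by (subst summable_on_reindex) (use nat in \<open>auto simp: o_def inj_def\<close>)
  have "(UNIV :: int set) = range int \<union> range (\<lambda>n. - int n)"
    by (auto simp: image_def) (metis int_cases2)
  then show ?thesis using summable_on_union[OF 1 2] by simp
qed

text \<open>The weight \<open>(1 + n\<^sup>2)\<^sup>2\<close> grows like \<open>n\<^sup>4\<close>, while a bounded third derivative makes the squared coefficients decay like
  \<open>n\<close> to the power \<open>- 6\<close>. Hence a sup bound on \<open>f'''\<close> controls the coefficients with \<open>n \<noteq> 0\<close>, and
  one on \<open>f\<close> controls the mean value.\<close>

lemma H2per_bound:
  assumes L: "L > 0"
  obtains K where "K \<ge> 0" and
    "\<And>f f' f'' f''' M. periodic_with L f \<Longrightarrow> (\<And>x. (f has_real_derivative f' x) (at x)) \<Longrightarrow>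
      (\<And>x. (f' has_real_derivative f'' x) (at x)) \<Longrightarrow> (\<And>x. (f'' has_real_derivative f''' x) (at x)) \<Longrightarrow>
      continuous_on UNIV f''' \<Longrightarrow> (\<And>x. x \<in> {0..L} \<Longrightarrow> \<bar>f x\<bar> \<le> M) \<Longrightarrow> (\<And>x. x \<in> {0..L} \<Longrightarrow> \<bar>f''' x\<bar> \<le> M) \<Longrightarrow>
      f \<in> H2per L \<and> H2per_norm L f \<le> K * M"
proof
  define a where "a = 2 * pi / L"
  define W where "W = (\<Sum>\<^sub>\<infinity>n::int. 1 / (1 + (of_int n)\<^sup>2) :: real)"
  define C where "C = 1 + 8 / a ^ 6"
  have a: "a > 0" using L by (simp add: a_def)
  have W: "W \<ge> 0" unfolding W_def by (intro infsum_nonneg) simp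
  have C: "C \<ge> 1" using a by (simp add: C_def)
  show "sqrt (L * (C * W)) \<ge> 0" using L W C by simp
  fix f f' f'' f''' and M :: real
  assume per: "periodic_with L f"
    and d: "\<And>x. (f has_real_derivative f' x) (at x)" "\<And>x. (f' has_real_derivative f'' x) (at x)"
      "\<And>x. (f'' has_real_derivative f''' x) (at x)"
    and cont3: "continuous_on UNIV f'''"
    and M: "\<And>x. x \<in> {0..L} \<Longrightarrow> \<bar>f x\<bar> \<le> M" "\<And>x. x \<in> {0..L} \<Longrightarrow> \<bar>f''' x\<bar> \<le> M"
  have M0: "M \<ge> 0" using M(1)[of 0] L by force
  have cont: "continuous_on UNIV f" "continuous_on UNIV f'" "continuous_on UNIV f''"
    using d by (meson DERIV_isCont continuous_at_imp_continuous_on)+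
  have per1: "periodic_with L f'" by (rule periodic_with_deriv[OF per d(1)])
  have per2: "periodic_with L f''" by (rule periodic_with_deriv[OF per1 d(2)])
  let ?t = "\<lambda>n::int. (1 + (of_int n)\<^sup>2)\<^sup>2 * (cmod (fourier_coeff L f n))\<^sup>2"
  have t: "?t n \<le> C * M\<^sup>2 * (1 / (1 + (of_int n)\<^sup>2))" for n
  proof (cases "n = 0")
    case True
    have "(cmod (fourier_coeff L f 0))\<^sup>2 \<le> M\<^sup>2"
      by (intro power_mono norm_fourier_coeff_le L cont M) auto
    also have "\<dots> \<le> C * M\<^sup>2" using C mult_right_mono[of 1 C "M\<^sup>2"] by simp
    finally show ?thesis using True by simp
  next
    case False
    define x where "x = (real_of_int n)\<^sup>2"
    have "\<bar>real_of_int n\<bar> \<ge> 1" using False by linarith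
    then have x: "x \<ge> 1" unfolding x_def by (metis one_le_power power2_abs)
    define y where "y = (cmod (fourier_coeff L f n))\<^sup>2"
    define c where "c = 2 * of_real pi * \<i> * of_int n / complex_of_real L"
    have "fourier_coeff L f''' n = c * (c * (c * fourier_coeff L f n))"
      by (simp only: fourier_coeff_deriv[OF L per2 d(3) cont3] fourier_coeff_deriv[OF L per1 d(2) cont(3)]
          fourier_coeff_deriv[OF L per d(1) cont(2)] c_def)
    moreover have "cmod c = a * \<bar>real_of_int n\<bar>"
      using L by (simp add: norm_mult norm_divide a_def c_def)
    ultimately have "cmod (fourier_coeff L f''' n) = (a * \<bar>real_of_int n\<bar>) ^ 3 * cmod (fourier_coeff L f n)"
      by (simp only: norm_mult power3_eq_cube mult.assoc)
    then have "(a * \<bar>real_of_int n\<bar>) ^ 3 * cmod (fourier_coeff L f n) \<le> M"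
      using norm_fourier_coeff_le[OF L cont3 M(2), of n] by simp
    then have "((a * \<bar>real_of_int n\<bar>) ^ 3 * cmod (fourier_coeff L f n))\<^sup>2 \<le> M\<^sup>2"
      using a by (intro power_mono) auto
    also have "((a * \<bar>real_of_int n\<bar>) ^ 3 * cmod (fourier_coeff L f n))\<^sup>2 = a ^ 6 * x ^ 3 * y"
      by (simp add: power_mult_distrib x_def y_def flip: power_mult)
    finally have y: "a ^ 6 * x ^ 3 * y \<le> M\<^sup>2" .
    have "(1 + x) ^ 3 \<le> (2 * x) ^ 3" using x by (intro power_mono) auto
    then have "(1 + x) ^ 3 * y \<le> 8 * x ^ 3 * y" by (intro mult_right_mono) (auto simp: y_def power_mult_distrib)
    also have "\<dots> \<le> 8 / a ^ 6 * M\<^sup>2" using mult_left_mono[OF y, of "8 / a ^ 6"] a by simp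
    also have "\<dots> \<le> C * M\<^sup>2" by (intro mult_right_mono) (auto simp: C_def)
    finally have "(1 + x)\<^sup>2 * y * (1 + x) \<le> C * M\<^sup>2" by (simp add: power2_eq_square power3_eq_cube mult_ac)
    then show ?thesis using x by (simp add: field_simps flip: x_def y_def)
  qed
  have sw: "(\<lambda>n::int. C * M\<^sup>2 * (1 / (1 + (of_int n)\<^sup>2))) summable_on UNIV"
    by (intro summable_on_cmult_right summable_on_inverse_one_plus_square)
  have st: "?t summable_on UNIV"
    by (rule summable_on_comparison_test[OF sw]) (use t in auto)
  have "infsum ?t UNIV \<le> C * M\<^sup>2 * W"
    unfolding W_def infsum_cmult_right'[symmetric] by (rule infsum_mono[OF st sw]) (use t in auto)
  then have "L * infsum ?t UNIV \<le> L * (C * W) * M\<^sup>2"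
    using L by (simp add: mult_ac)
  then have "H2per_norm L f \<le> sqrt (L * (C * W)) * M"
    using M0 real_sqrt_le_mono unfolding H2per_norm_def by (fastforce simp: real_sqrt_mult)
  moreover have "f \<in> H2per L"
    unfolding H2per_def
  proof (intro CollectI conjI per st)
    show "f \<in> borel_measurable lebesgue"
      using borel_measurable_continuous_onI[OF cont(1)] by (simp add: measurable_completion)
    show "set_integrable lebesgue {0..L} (\<lambda>x. (f x)\<^sup>2)"
      by (intro absolutely_integrable_continuous_real continuous_intros continuous_on_subset[OF cont(1)]) auto
  qed
  ultimately show "f \<in> H2per L \<and> H2per_norm L f \<le> sqrt (L * (C * W)) * M" by simp
qed

definition partial_fst :: "(real \<times> real \<Rightarrow> real) \<Rightarrow> real \<times> real \<Rightarrow> real" where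
  "partial_fst p z = frechet_derivative p (at z) (1, 0)"

definition partial_snd :: "(real \<times> real \<Rightarrow> real) \<Rightarrow> real \<times> real \<Rightarrow> real" where
  "partial_snd p z = frechet_derivative p (at z) (0, 1)"

lemma smooth_on_partials:
  assumes "smooth_on S p"
  shows "smooth_on S (partial_fst p)" "smooth_on S (partial_snd p)"
  using smooth_on_frechet_derivative[OF assms] by (simp_all add: partial_fst_def[abs_def] partial_snd_def[abs_def])

lemma has_real_derivative_partials:
  assumes "smooth_on S p" "(w, x) \<in> S"
  shows "((\<lambda>w. p (w, x)) has_real_derivative partial_fst p (w, x)) (at w)"
    and "((\<lambda>x. p (w, x)) has_real_derivative partial_snd p (w, x)) (at x)"
proof -
  let ?D = "frechet_derivative p (at (w, x))"
  have D: "(p has_derivative ?D) (at (w, x))" by (rule smooth_on_has_derivative[OF assms])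
  then interpret bounded_linear ?D by (rule has_derivative_bounded_linear)
  have "((\<lambda>w. (w, x)) has_derivative (\<lambda>h. (h, 0))) (at w)" by (auto intro!: derivative_eq_intros)
  from has_derivative_compose[OF this D] have "((\<lambda>w. p (w, x)) has_derivative (\<lambda>h. ?D (h, 0))) (at w)" .
  moreover have "?D (h, 0) = partial_fst p (w, x) * h" for h
    using scaleR[of h "(1, 0)"] by (simp add: partial_fst_def mult.commute)
  ultimately show "((\<lambda>w. p (w, x)) has_real_derivative partial_fst p (w, x)) (at w)"
    by (simp add: has_field_derivative_def)
  have "((\<lambda>x. (w, x)) has_derivative (\<lambda>h. (0, h))) (at x)" by (auto intro!: derivative_eq_intros)
  from has_derivative_compose[OF this D] have "((\<lambda>x. p (w, x)) has_derivative (\<lambda>h. ?D (0, h))) (at x)" .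
  moreover have "?D (0, h) = partial_snd p (w, x) * h" for h
    using scaleR[of h "(0, 1)"] by (simp add: partial_snd_def mult.commute)
  ultimately show "((\<lambda>x. p (w, x)) has_real_derivative partial_snd p (w, x)) (at x)"
    by (simp add: has_field_derivative_def)
qed

lemma periodic_with_partial_fst:
  fixes p :: "real \<times> real \<Rightarrow> real"
  assumes "open I" "smooth_on (I \<times> UNIV) p" "\<And>w. w \<in> I \<Longrightarrow> periodic_with L (\<lambda>x. p (w, x))" "w \<in> I"
  shows "periodic_with L (\<lambda>x. partial_fst p (w, x))"
  unfolding periodic_with_def
proof
  fix x
  have "((\<lambda>w. p (w, x + L)) has_real_derivative partial_fst p (w, x + L)) (at w)"
    using assms(4) by (intro has_real_derivative_partials[OF assms(2)]) simp
  then have "((\<lambda>w. p (w, x)) has_real_derivative partial_fst p (w, x + L)) (at w)"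
    by (rule has_field_derivative_transform_within_open[OF _ assms(1,4)])
      (use assms(3) in \<open>simp add: periodic_with_def\<close>)
  then show "partial_fst p (w, x + L) = partial_fst p (w, x)"
    using has_real_derivative_partials(1)[OF assms(2), of w x] assms(4) DERIV_unique by blast
qed

lemma uniform_continuity_in_parameter:
  fixes q :: "real \<times> real \<Rightarrow> real"
  assumes "open I" "w \<in> I" "continuous_on (I \<times> UNIV) q" "\<epsilon> > 0"
  obtains \<delta> where "\<delta> > 0" "cball w \<delta> \<subseteq> I"
    "\<And>t x. \<bar>t\<bar> \<le> \<delta> \<Longrightarrow> x \<in> {0..L} \<Longrightarrow> \<bar>q (w + t, x) - q (w, x)\<bar> \<le> \<epsilon>"
proof -
  obtain r where r: "r > 0" "cball w r \<subseteq> I" using assms(1,2) open_contains_cball by blast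
  have "uniformly_continuous_on (cball w r \<times> {0..L}) q"
    using r by (intro compact_uniformly_continuous continuous_on_subset[OF assms(3)] compact_Times) auto
  then obtain d where d: "d > 0"
    "\<And>z z'. z \<in> cball w r \<times> {0..L} \<Longrightarrow> z' \<in> cball w r \<times> {0..L} \<Longrightarrow> dist z' z < d \<Longrightarrow> dist (q z') (q z) < \<epsilon>"
    using assms(4) unfolding uniformly_continuous_on_def by meson
  show ?thesis
  proof
    show "min r (d / 2) > 0" using r d by simp
    show "cball w (min r (d / 2)) \<subseteq> I" using r(2) by auto
    show "\<bar>q (w + t, x) - q (w, x)\<bar> \<le> \<epsilon>" if "\<bar>t\<bar> \<le> min r (d / 2)" "x \<in> {0..L}" for t x
      using d(2)[of "(w, x)" "(w + t, x)"] that r(1) d(1)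
      by (force simp: dist_real_def dist_Pair_Pair)
  qed
qed

lemma has_real_derivative_parameter_mean:
  fixes q :: "real \<times> real \<Rightarrow> real"
  assumes q: "smooth_on (I \<times> UNIV) q" and seg: "\<And>s. s \<in> {0..1} \<Longrightarrow> w + h * s \<in> I"
  shows "((\<lambda>x. integral {0..1} (\<lambda>s. q (w + h * s, x))) has_real_derivative
    integral {0..1} (\<lambda>s. partial_snd q (w + h * s, x))) (at x)"
proof -
  have cont: "continuous_on (UNIV \<times> {0..1}) (\<lambda>z. g (w + h * snd z, fst z))" if "smooth_on (I \<times> UNIV) g" for g
    using seg by (intro continuous_on_compose2[OF smooth_on_imp_continuous_on[OF that]] continuous_intros) auto
  have "((\<lambda>x. integral (cbox 0 1) (\<lambda>s. q (w + h * s, x))) has_field_derivative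
      integral (cbox 0 1) (\<lambda>s. partial_snd q (w + h * s, x))) (at x within UNIV)"
  proof (rule leibniz_rule_field_derivative)
    show "((\<lambda>x. q (w + h * s, x)) has_real_derivative partial_snd q (w + h * s, x)) (at x within UNIV)"
      if "s \<in> cbox 0 1" for x s
      using has_real_derivative_partials(2)[OF q, of "w + h * s" x] seg[of s] that by (simp add: cbox_interval)
    show "(\<lambda>s. q (w + h * s, x)) integrable_on cbox 0 1" for x
    proof -
      have "continuous_on {0..1} (\<lambda>s. (\<lambda>z. q (w + h * snd z, fst z)) (x, s))"
        by (rule continuous_on_compose2[OF cont[OF q]]) (auto intro!: continuous_intros)
      then show ?thesis by (simp add: cbox_interval integrable_continuous_real)
    qed
    show "continuous_on (UNIV \<times> cbox 0 1) (\<lambda>(x, s). partial_snd q (w + h * s, x))"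
      using cont[OF smooth_on_partials(2)[OF q]] by (simp add: case_prod_unfold cbox_interval)
  qed auto
  then show ?thesis by (simp add: cbox_interval)
qed

text \<open>Once the difference quotient is an average of \<open>partial_fst p\<close>, its derivatives in \<open>x\<close> are averages of the derivatives of
  \<open>partial_fst p\<close> in \<open>x\<close>, which are the functions that occur in the limit.\<close>

lemma difference_quotient_eq_parameter_mean:
  fixes p :: "real \<times> real \<Rightarrow> real"
  assumes p: "smooth_on (I \<times> UNIV) p" and seg: "\<And>s. s \<in> {0..1} \<Longrightarrow> w + h * s \<in> I" and "h \<noteq> 0"
  shows "(p (w + h, x) - p (w, x)) / h = integral {0..1} (\<lambda>s. partial_fst p (w + h * s, x))"
proof -
  have "((\<lambda>s. h * partial_fst p (w + h * s, x)) has_integral p (w + h * 1, x) - p (w + h * 0, x)) {0..1}"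
  proof (rule fundamental_theorem_of_calculus)
    fix s :: real assume "s \<in> {0..1}"
    then have "((\<lambda>w. p (w, x)) has_real_derivative partial_fst p (w + h * s, x)) (at (w + h * s))"
      using seg by (intro has_real_derivative_partials(1)[OF p]) simp
    moreover have "((\<lambda>s. w + h * s) has_real_derivative h) (at s)"
      by (auto intro!: derivative_eq_intros)
    ultimately have "((\<lambda>s. p (w + h * s, x)) has_real_derivative partial_fst p (w + h * s, x) * h) (at s)"
      by (rule DERIV_chain2)
    then show "((\<lambda>s. p (w + h * s, x)) has_vector_derivative h * partial_fst p (w + h * s, x)) (at s within {0..1})"
      by (simp add: has_real_derivative_iff_has_vector_derivative has_vector_derivative_at_within mult.commute)
  qed simp
  from integral_unique[OF this] show ?thesis using assms(3) by (simp add: field_simps)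
qed

lemma parameter_mean_close:
  fixes q :: "real \<times> real \<Rightarrow> real"
  assumes q: "smooth_on (I \<times> UNIV) q" and seg: "\<And>s. s \<in> {0..1} \<Longrightarrow> w + h * s \<in> I"
    and bnd: "\<And>s. s \<in> {0..1} \<Longrightarrow> \<bar>q (w + h * s, x) - q (w, x)\<bar> \<le> \<epsilon>"
  shows "\<bar>integral {0..1} (\<lambda>s. q (w + h * s, x)) - q (w, x)\<bar> \<le> \<epsilon>"
proof -
  have "continuous_on {0..1} (\<lambda>s. q (w + h * s, x))"
    using seg by (intro continuous_on_compose2[OF smooth_on_imp_continuous_on[OF q]] continuous_intros) auto
  then have int: "(\<lambda>s. q (w + h * s, x)) integrable_on {0..1}" by (rule integrable_continuous_real)
  have I: "((\<lambda>s. q (w + h * s, x) - q (w, x)) has_integral integral {0..1} (\<lambda>s. q (w + h * s, x)) - q (w, x)) {0..1}"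
    using has_integral_diff[OF integrable_integral[OF int] has_integral_const_real[of "q (w, x)" 0 1]] by simp
  have "0 \<le> \<epsilon>" using bnd[of 0] by force
  then have "norm (integral {0..1} (\<lambda>s. q (w + h * s, x)) - q (w, x)) \<le> \<epsilon> * measure lborel {0..1::real}"
    by (rule has_integral_bound_real[OF _ finite.emptyI I]) (use bnd in simp)
  then show ?thesis by simp
qed

lemma H2per_slice:
  fixes p :: "real \<times> real \<Rightarrow> real"
  assumes "L > 0" "open I" "smooth_on (I \<times> UNIV) p" "\<And>w. w \<in> I \<Longrightarrow> periodic_with L (\<lambda>x. p (w, x))" "w \<in> I"
  shows "(\<lambda>x. p (w, x)) \<in> H2per L"
proof -
  let ?d = partial_snd
  have sm: "smooth_on (I \<times> UNIV) (?d p)" "smooth_on (I \<times> UNIV) (?d (?d p))" "smooth_on (I \<times> UNIV) (?d (?d (?d p)))"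
    using assms(3) by (auto intro: smooth_on_partials)
  have w: "(w, x) \<in> I \<times> UNIV" for x :: real using assms(5) by simp
  have cont: "continuous_on A (\<lambda>x. q (w, x))" if "smooth_on (I \<times> UNIV) q"
    for q :: "real \<times> real \<Rightarrow> real" and A
    by (rule continuous_on_compose2[OF smooth_on_imp_continuous_on[OF that]]) (use w in \<open>auto intro!: continuous_intros\<close>)
  have bdd: "\<exists>M. \<forall>x\<in>{0..L}. \<bar>q (w, x)\<bar> \<le> M" if "smooth_on (I \<times> UNIV) q" for q :: "real \<times> real \<Rightarrow> real"
    using compact_imp_bounded[OF compact_continuous_image[OF cont[OF that] compact_Icc[of 0 L]]]
    by (simp add: bounded_iff)
  obtain M1 where M1: "\<And>x. x \<in> {0..L} \<Longrightarrow> \<bar>p (w, x)\<bar> \<le> M1"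
    using bdd[OF assms(3)] by blast
  obtain M2 where M2: "\<And>x. x \<in> {0..L} \<Longrightarrow> \<bar>?d (?d (?d p)) (w, x)\<bar> \<le> M2"
    using bdd[OF sm(3)] by blast
  obtain K where K: "\<And>f f' f'' f''' M. periodic_with L f \<Longrightarrow> (\<And>x. (f has_real_derivative f' x) (at x)) \<Longrightarrow>
      (\<And>x. (f' has_real_derivative f'' x) (at x)) \<Longrightarrow> (\<And>x. (f'' has_real_derivative f''' x) (at x)) \<Longrightarrow>
      continuous_on UNIV f''' \<Longrightarrow> (\<And>x. x \<in> {0..L} \<Longrightarrow> \<bar>f x\<bar> \<le> M) \<Longrightarrow> (\<And>x. x \<in> {0..L} \<Longrightarrow> \<bar>f''' x\<bar> \<le> M) \<Longrightarrow>
      f \<in> H2per L \<and> H2per_norm L f \<le> K * M"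
    using H2per_bound[OF assms(1)] by metis
  have "(\<lambda>x. p (w, x)) \<in> H2per L \<and> H2per_norm L (\<lambda>x. p (w, x)) \<le> K * max M1 M2"
    by (rule K[OF assms(4)[OF assms(5)] has_real_derivative_partials(2)[OF assms(3) w]
          has_real_derivative_partials(2)[OF sm(1) w] has_real_derivative_partials(2)[OF sm(2) w] cont[OF sm(3)]])
      (use M1 M2 in \<open>force simp: le_max_iff_disj\<close>)+
  then show ?thesis ..
qed

text \<open>The error of the difference quotient is \<open>e r\<close>, the deviation of the average of \<open>r = partial_fst p\<close> from its value at
  \<open>w\<close>. Its third derivative in \<open>x\<close> is the same deviation for the third derivative of \<open>r\<close>. Both are uniformly small over a
  period by uniform continuity, and the norm is bounded by such suprema.\<close>

lemma H2per_difference_quotient_tendsto: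
  fixes p :: "real \<times> real \<Rightarrow> real"
  assumes "L > 0" "open I" "smooth_on (I \<times> UNIV) p" "\<And>w. w \<in> I \<Longrightarrow> periodic_with L (\<lambda>x. p (w, x))" "w \<in> I"
  shows "((\<lambda>h. H2per_norm L (\<lambda>x. (p (w + h, x) - p (w, x)) / h - partial_fst p (w, x))) \<longlongrightarrow> 0) (at 0)"
proof -
  let ?d = partial_snd
  define r where "r = partial_fst p"
  have sm: "smooth_on (I \<times> UNIV) r" "smooth_on (I \<times> UNIV) (?d r)" "smooth_on (I \<times> UNIV) (?d (?d r))"
     "smooth_on (I \<times> UNIV) (?d (?d (?d r)))"
    using assms(3) by (auto simp: r_def intro: smooth_on_partials)
  have w: "(w, x) \<in> I \<times> UNIV" for x :: real using assms(5) by simp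
  obtain K where K0: "K \<ge> 0" and K: "\<And>f f' f'' f''' M. periodic_with L f \<Longrightarrow> (\<And>x. (f has_real_derivative f' x) (at x)) \<Longrightarrow>
      (\<And>x. (f' has_real_derivative f'' x) (at x)) \<Longrightarrow> (\<And>x. (f'' has_real_derivative f''' x) (at x)) \<Longrightarrow>
      continuous_on UNIV f''' \<Longrightarrow> (\<And>x. x \<in> {0..L} \<Longrightarrow> \<bar>f x\<bar> \<le> M) \<Longrightarrow> (\<And>x. x \<in> {0..L} \<Longrightarrow> \<bar>f''' x\<bar> \<le> M) \<Longrightarrow>
      f \<in> H2per L \<and> H2per_norm L f \<le> K * M"
    using H2per_bound[OF assms(1)] by metis
  have *: "\<exists>\<delta>>0. \<forall>h. h \<noteq> 0 \<and> \<bar>h\<bar> < \<delta> \<longrightarrow>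
      H2per_norm L (\<lambda>x. (p (w + h, x) - p (w, x)) / h - r (w, x)) \<le> K * \<epsilon>" if \<epsilon>: "\<epsilon> > 0" for \<epsilon>
  proof -
    obtain \<delta>1 where \<delta>1: "\<delta>1 > 0" "cball w \<delta>1 \<subseteq> I"
        "\<And>t x. \<bar>t\<bar> \<le> \<delta>1 \<Longrightarrow> x \<in> {0..L} \<Longrightarrow> \<bar>r (w + t, x) - r (w, x)\<bar> \<le> \<epsilon>"
      using uniform_continuity_in_parameter[OF assms(2,5) smooth_on_imp_continuous_on[OF sm(1)] \<epsilon>] by metis
    obtain \<delta>2 where \<delta>2: "\<delta>2 > 0"
        "\<And>t x. \<bar>t\<bar> \<le> \<delta>2 \<Longrightarrow> x \<in> {0..L} \<Longrightarrow> \<bar>?d (?d (?d r)) (w + t, x) - ?d (?d (?d r)) (w, x)\<bar> \<le> \<epsilon>"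
      using uniform_continuity_in_parameter[OF assms(2,5) smooth_on_imp_continuous_on[OF sm(4)] \<epsilon>] by metis
    have "H2per_norm L (\<lambda>x. (p (w + h, x) - p (w, x)) / h - r (w, x)) \<le> K * \<epsilon>"
      if h: "h \<noteq> 0" "\<bar>h\<bar> < min \<delta>1 \<delta>2" for h
    proof -
      have hs: "\<bar>h * s\<bar> \<le> min \<delta>1 \<delta>2" if "s \<in> {0..1}" for s
        using that h(2) mult_left_le[of "\<bar>s\<bar>" "\<bar>h\<bar>"] by (auto simp: abs_mult)
      have seg: "w + h * s \<in> I" if "s \<in> {0..1}" for s
        using hs[OF that] \<delta>1(2) by (auto simp: dist_real_def subset_iff)
      define e :: "(real \<times> real \<Rightarrow> real) \<Rightarrow> real \<Rightarrow> real" where "e q x = integral {0..1} (\<lambda>s. q (w + h * s, x)) - q (w, x)" for q x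
      have de: "(e q has_real_derivative e (?d q) x) (at x)" if "smooth_on (I \<times> UNIV) q" for q x
        unfolding e_def[abs_def]
        by (intro DERIV_diff has_real_derivative_parameter_mean[OF that seg] has_real_derivative_partials(2)[OF that w])
      have eq: "(\<lambda>x. (p (w + h, x) - p (w, x)) / h - r (w, x)) = e r"
        using difference_quotient_eq_parameter_mean[OF assms(3) seg h(1)] by (simp add: e_def[abs_def] r_def)
      have "w + h \<in> I" using seg[of 1] by simp
      then have per: "periodic_with L (e r)"
        using assms(4)[of w] assms(4)[of "w + h"] assms(5) periodic_with_partial_fst[OF assms(2-5)]
        unfolding eq[symmetric] by (simp add: periodic_with_def r_def)
      have "continuous_on UNIV (e (?d (?d (?d r))))"
        using de[OF sm(4)] by (meson DERIV_isCont continuous_at_imp_continuous_on)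
      moreover have "\<bar>e r x\<bar> \<le> \<epsilon>" "\<bar>e (?d (?d (?d r))) x\<bar> \<le> \<epsilon>" if "x \<in> {0..L}" for x
        unfolding e_def using \<delta>1(3)[OF _ that] \<delta>2(2)[OF _ that] hs
        by (auto intro!: parameter_mean_close[OF _ seg] sm)
      ultimately have "e r \<in> H2per L \<and> H2per_norm L (e r) \<le> K * \<epsilon>"
        by (intro K[OF per de[OF sm(1)] de[OF sm(2)] de[OF sm(3)]])
      then show ?thesis unfolding eq ..
    qed
    then show ?thesis using \<delta>1(1) \<delta>2(1) by (intro exI[of _ "min \<delta>1 \<delta>2"]) auto
  qed
  have "\<exists>\<delta>>0. \<forall>h. h \<noteq> 0 \<and> \<bar>h\<bar> < \<delta> \<longrightarrow>
      \<bar>H2per_norm L (\<lambda>x. (p (w + h, x) - p (w, x)) / h - r (w, x))\<bar> < \<eta>" if \<eta>: "\<eta> > 0" for \<eta>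
  proof -
    \<comment> \<open>\<open>K\<close> may vanish, hence the denominator \<open>K + 1\<close>\<close>
    have lt: "K * (\<eta> / (2 * (K + 1))) < \<eta>" using K0 \<eta> by (simp add: field_simps add_nonneg_pos)
    have "0 < \<eta> / (2 * (K + 1))" using K0 \<eta> by simp
    then obtain \<delta> where \<delta>: "\<delta> > 0" "\<And>h. h \<noteq> 0 \<Longrightarrow> \<bar>h\<bar> < \<delta> \<Longrightarrow>
        H2per_norm L (\<lambda>x. (p (w + h, x) - p (w, x)) / h - r (w, x)) \<le> K * (\<eta> / (2 * (K + 1)))"
      using *[of "\<eta> / (2 * (K + 1))"] by blast
    moreover have "\<bar>H2per_norm L f\<bar> = H2per_norm L f" for f
      using assms(1) unfolding H2per_norm_def
      by (intro abs_of_nonneg real_sqrt_ge_zero mult_nonneg_nonneg infsum_nonneg) auto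
    ultimately show ?thesis
      using lt by (intro exI[of _ \<delta>]) (simp only:, blast intro: order_le_less_trans)
  qed
  then show ?thesis unfolding r_def by (simp add: LIM_eq)
qed

text \<open>The derivatives of the curve are the iterated partial derivatives in the parameter. Each of them is again jointly
  smooth and periodic, so a single limit of difference quotients settles all orders.\<close>

lemma smooth_H2per_curveI:
  assumes L: "L > 0" and I: "open I" and sm: "smooth_on (I \<times> UNIV) (\<lambda>(w, x). \<Gamma> w x)"
    and per: "\<And>w. w \<in> I \<Longrightarrow> periodic_with L (\<Gamma> w)"
  shows "smooth_H2per_curve L I \<Gamma>"
proof -
  define P where "P n = (partial_fst ^^ n) (\<lambda>(w, x). \<Gamma> w x)" for n
  have P: "smooth_on (I \<times> UNIV) (P n)" "\<And>w. w \<in> I \<Longrightarrow> periodic_with L (\<lambda>x. P n (w, x))" for n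
  proof (induction n)
    case 0
    show "smooth_on (I \<times> UNIV) (P 0)" "\<And>w. w \<in> I \<Longrightarrow> periodic_with L (\<lambda>x. P 0 (w, x))"
      using sm per by (simp_all add: P_def)
  next
    case (Suc n)
    have "P (Suc n) = partial_fst (P n)" by (simp add: P_def)
    then show "smooth_on (I \<times> UNIV) (P (Suc n))" "\<And>w. w \<in> I \<Longrightarrow> periodic_with L (\<lambda>x. P (Suc n) (w, x))"
      using smooth_on_partials(1)[OF Suc.IH(1)] periodic_with_partial_fst[OF I Suc.IH] by simp_all
  qed
  show ?thesis
    unfolding smooth_H2per_curve_def
  proof (intro exI[of _ "\<lambda>n w x. P n (w, x)"] conjI ballI allI)
    fix w assume w: "w \<in> I"
    show "(\<lambda>x. P 0 (w, x)) = \<Gamma> w" by (simp add: P_def)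
    fix n
    show "(\<lambda>x. P n (w, x)) \<in> H2per L" by (rule H2per_slice[OF L I P w])
    have "P (Suc n) = partial_fst (P n)" by (simp add: P_def)
    then show "((\<lambda>h. H2per_norm L (\<lambda>x. (P n (w + h, x) - P n (w, x)) / h - P (Suc n) (w, x))) \<longlongrightarrow> 0) (at 0)"
      using H2per_difference_quotient_tendsto[OF L I P w] by simp
  qed
qed

section \<open>The snoidal curve\<close>

theorem proposition2p2:
  fixes \<kappa> \<gamma> B L :: real
  assumes "\<kappa> > 0" and "\<gamma> \<ge> 0"
    and "(\<gamma> > 2 * \<kappa> \<and> (B = (\<gamma> + sqrt (\<gamma>\<^sup>2 - 4 * \<kappa>\<^sup>2)) / (2 * \<kappa>) \<or>
                       B = (\<gamma> - sqrt (\<gamma>\<^sup>2 - 4 * \<kappa>\<^sup>2)) / (2 * \<kappa>)))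
         \<or> B = 1 \<or> (\<gamma> < \<kappa> \<and> B = - 1)"
    and "L > 0"
  shows "(\<forall>k\<in>{0<..<1}.
            a_tilde k L \<in> {- (2 * sqrt 3 / 3 * sqrt (pi / L))<..<0} \<and>
            q_tilde k \<in> {2/3<..<1} \<and>
            freq k L \<in> {4 * pi\<^sup>2 / L\<^sup>2<..} \<and>
            periodic_with L (snoidal \<kappa> \<gamma> B L k) \<and>
            solves_eq \<kappa> \<gamma> B (freq k L) (snoidal \<kappa> \<gamma> B L k))
       \<and> smooth_on ({0<..<1} \<times> {0<..}) (\<lambda>(k, l). a_tilde k l)
       \<and> smooth_on ({0<..<1} \<times> {0<..}) (\<lambda>(k, l :: real). q_tilde k)
       \<and> smooth_on ({0<..<1} \<times> {0<..}) (\<lambda>(k, l). freq k l)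
       \<and> bij_betw (\<lambda>k. freq k L) {0<..<1} {4 * pi\<^sup>2 / L\<^sup>2<..}
       \<and> (\<forall>\<omega>\<in>{4 * pi\<^sup>2 / L\<^sup>2<..}.
            periodic_with L (psi \<kappa> \<gamma> B L \<omega>) \<and> solves_eq \<kappa> \<gamma> B \<omega> (psi \<kappa> \<gamma> B L \<omega>))
       \<and> smooth_H2per_curve L {4 * pi\<^sup>2 / L\<^sup>2<..} (psi \<kappa> \<gamma> B L)"
proof (intro conjI ballI)
  note L = assms(4)
  have c: "\<kappa> + \<gamma> * B^3 > 0" by (rule coefficient_pos[OF assms(1-3)])
  show "a_tilde k L \<in> {- (2 * sqrt 3 / 3 * sqrt (pi / L))<..<0}" "q_tilde k \<in> {2/3<..<1}"
    "freq k L \<in> {4 * pi\<^sup>2 / L\<^sup>2<..}" "periodic_with L (snoidal \<kappa> \<gamma> B L k)"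
    "solves_eq \<kappa> \<gamma> B (freq k L) (snoidal \<kappa> \<gamma> B L k)" if "k \<in> {0<..<1}" for k
    using that a_tilde_gt[OF that L] a_tilde_neg[OF that L] q_tilde_bounds[OF that]
      bij_betwE[OF bij_betw_freq[OF L]] periodic_with_snoidal[OF that L] solves_eq_snoidal[OF c that L]
    by auto
  have "open ({0<..<1} \<times> {0<..} :: (real \<times> real) set)" by (intro open_Times) auto
  then show "smooth_on ({0<..<1} \<times> {0<..}) (\<lambda>(k, l). a_tilde k l)"
    "smooth_on ({0<..<1} \<times> {0<..}) (\<lambda>(k, l :: real). q_tilde k)"
    "smooth_on ({0<..<1} \<times> {0<..}) (\<lambda>(k, l). freq k l)"
    unfolding case_prod_unfold
    by (intro smooth_on_compose_a_tilde smooth_on_compose_q_tilde smooth_on_compose_freq smooth_intros; force)+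
  show "bij_betw (\<lambda>k. freq k L) {0<..<1} {4 * pi\<^sup>2 / L\<^sup>2<..}" by (rule bij_betw_freq[OF L])
  show per: "periodic_with L (psi \<kappa> \<gamma> B L \<omega>)" if "\<omega> \<in> {4 * pi\<^sup>2 / L\<^sup>2<..}" for \<omega>
    unfolding psi_def by (rule periodic_with_snoidal[OF modulus_of_in(1)[OF L that] L])
  show "solves_eq \<kappa> \<gamma> B \<omega> (psi \<kappa> \<gamma> B L \<omega>)" if "\<omega> \<in> {4 * pi\<^sup>2 / L\<^sup>2<..}" for \<omega>
    using solves_eq_snoidal[OF c modulus_of_in(1)[OF L that] L] modulus_of_in(2)[OF L that] by (simp add: psi_def)
  show "smooth_H2per_curve L {4 * pi\<^sup>2 / L\<^sup>2<..} (psi \<kappa> \<gamma> B L)"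
    by (rule smooth_H2per_curveI[OF L _ smooth_on_psi[OF c L] per]) auto
qed

end
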